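(* Let $X$ be an $\mathbb{R}^d$-valued random vector with probability density $p>0$ ($\lambda_d$-a.e.), and let $F:\mathbb{R}^d\to\mathbb{R}$ be a Borel function with $\mathbb{E}[F(X)^2]<+\infty$. Assume: (1) $p$ is strictly log-concave and $\lim_{|x|\to+\infty}p(x)=0$. (2) $p$ is twice differentiable and there is $\alpha\in(0,1]$ such that (i) $\left|\frac{Dp}{p}\right|(x)=O(|x|^{\alpha})$ as $|x|\to+\infty$; (ii) there is $C>0$ such that for all $x\in\mathbb{R}^d$, $\frac{1}{p(x)}|D^2p|(x)\le C\left(|x|^{2\alpha}+\frac{1}{|x|^{1-\alpha}}\right)$. (3) $F$ is positive and convex on $\mathbb{R}^d$, (i) $F$ is Lipschitz on $\mathbb{R}^d$, and (ii) there is $a>1$ such that $\mathbb{E}[F^{4a}(X)]<+\infty$ and, for all $M>0$, $\mathbb{E}\left[|X|^{\frac{4a}{a-1}}+e^{M|X|}\right]<+\infty$. (4) The function $\frac{Dp}{p}$ is $\alpha$-Hölder (same $\alpha$ as in (2)). For each $N\ge1$ let $x^{(N)}$ be an $L^2$-optimal stationary $N$-quantizer of $X$ with associated Voronoi quantization $\widehat X=\widehat X^{x^{(N)}}$. Let $\theta^*$ be the unique global minimizer of $Q$ on $\mathbb{R}^d$ and let $\widehat\theta^N$ be the unique global minimizer of $\widehat Q_N$ on $\mathbb{R}^d$. Then for every $N\ge1$ there exists $\eta_N>0$ such that, if $|\widehat\theta_0-\widehat\theta^N|\le\eta_N$, the sequence $(\widehat\theta_n)_{n\ge0}$ defined by $$\widehat\theta_{n+1}=\widehat\theta_n-D^2\widehat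 Q_N(\widehat\theta_n)^{-1}D\widehat Q_N(\widehat\theta_n),\qquad n\ge0,\quad \widehat\theta_0\text{ given},$$ converges to $\widehat\theta^N$. Moreover, the convergence rate of $(\widehat\theta^N)_{N\ge1}$ to $\theta^*$ is controlled by the $L^2$-quantization error, in the sense that $$|\widehat\theta^N-\theta^*|=O\left(\left\|X-\widehat X\right\|_2^{\alpha}\right)\quad\text{as }N\to+\infty.$$
   Context: Notation: $|\cdot|$ is the Euclidean norm (or a matrix norm), $\|Y\|_2=(\mathbb{E}|Y|^2)^{1/2}$, $\lambda_d$ is Lebesgue measure on $\mathbb{R}^d$, $Dp$ and $D^2p$ are the gradient and Hessian of $p$. In (2)(ii), $\frac{1}{|x|^{1-\alpha}}$ is read as $+\infty$ at $x=0$ if $\alpha<1$, and as $1$ for all $x$ if $\alpha=1$. The function $Q$ is $$Q(\theta)=\mathbb{E}\left[F^2(X)\frac{p(X)}{p(X-\theta)}\right],\qquad\theta\in\mathbb{R}^d.$$ Quantization: for an $N$-tuple $x=(x_1,\dots,x_N)\in(\mathbb{R}^d)^N$, let $\mathrm{Proj}_x:\mathbb{R}^d\to\{x_1,\dots,x_N\}$ be a Borel nearest-neighbour projection, $C_i(x)=\mathrm{Proj}_x^{-1}(\{x_i\})$ the Voronoi cells, and $\widehat X^{x}=\mathrm{Proj}_x(X)$ the Voronoi quantization of $X$. The $N$-tuple $x$ is $L^2$-optimal if it minimizes $y\mapsto\left\|\min_{1\le i\le N}|X-y_i|\right\|_2$ over $(\mathbb{R}^d)^N$. It is stationary if the $x_i$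 are pairwise distinct, $\mathbb{P}(X\in\cup_i\partial C_i(x))=0$ and $\mathbb{E}[X\mid\widehat X^{x}]=\widehat X^{x}$. The quantized functions are $$\widehat Q_N(\theta)=\mathbb{E}\left[F^2(\widehat X)\frac{p(\widehat X)}{p(\widehat X-\theta)}\right],\qquad D\widehat Q_N(\theta)=\mathbb{E}\left[F^2(\widehat X)\frac{p(\widehat X)}{p^2(\widehat X-\theta)}Dp(\widehat X-\theta)\right],$$ $$D^2\widehat Q_N(\theta)=\mathbb{E}\left[F^2(\widehat X)\frac{p(\widehat X)}{p(\widehat X-\theta)}\left(2\frac{Dp(\widehat X-\theta)Dp(\widehat X-\theta)^T}{p^2(\widehat X-\theta)}-\frac{D^2p(\widehat X-\theta)}{p(\widehat X-\theta)}\right)\right],$$ i.e. finite sums over the points $x_i$ with weights $\mathbb{P}(X\in C_i(x))$. For $N$ large enough, $F(x_i)\ne0$ for some $i$, and then $\widehat Q_N$ is strictly convex and tends to infinity at infinity, so it has a unique global minimizer $\widehat\theta^N$, and $D^2\widehat Q_N(\theta)$ is symmetric positive definite for every $\theta$.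
   Formalization: For the convergence of Newton's iteration, p is assumed twice continuously differentiable (for merely twice differentiable p it can fail), and the positive definiteness of the Hessian of the quantized function at every point is taken as a premise; the convergence rate needs neither. *)

theory Defs
  imports "HOL-Probability.Probability" "HOL-Library.Landau_Symbols"
begin

section \<open>Densities and regularity\<close>

text \<open>Strict concavity of the logarithm of \<open>f\<close>, with value minus infinity where \<open>f \<le> 0\<close>: the domain
  of the logarithm is convex and the logarithm is strictly concave there.\<close>

definition strictly_log_concave :: "('v::real_vector \<Rightarrow> real) \<Rightarrow> bool" where
  "strictly_log_concave f \<longleftrightarrow>
     (\<forall>x y t. 0 < f x \<longrightarrow> 0 < f y \<longrightarrow> x \<noteq> y \<longrightarrow> 0 < t \<longrightarrow> t < 1 \<longrightarrow>
        0 < f ((1 - t) *\<^sub>R x + t *\<^sub>R y) \<and>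
        (1 - t) * ln (f x) + t * ln (f y) < ln (f ((1 - t) *\<^sub>R x + t *\<^sub>R y)))"

definition twice_differentiable_with ::
  "(real^'n \<Rightarrow> real) \<Rightarrow> (real^'n \<Rightarrow> real^'n) \<Rightarrow> (real^'n \<Rightarrow> real^'n^'n) \<Rightarrow> bool" where
  "twice_differentiable_with f Df D2f \<longleftrightarrow>
     (\<forall>x. GDERIV f x :> Df x) \<and> (\<forall>x. (Df has_derivative (\<lambda>h. D2f x *v h)) (at x))"

definition hoelder :: "real \<Rightarrow> ('v::real_normed_vector \<Rightarrow> 'w::real_normed_vector) \<Rightarrow> bool" where
  "hoelder \<alpha> f \<longleftrightarrow> (\<exists>K. \<forall>x y. norm (f x - f y) \<le> K * norm (x - y) powr \<alpha>)"

text \<open>The condition \<open>|D2f| / f \<le> C (|x|^(2 \<alpha>) + 1 / |x|^(1 - \<alpha>))\<close>. For \<open>\<alpha> < 1\<close> the last term is plus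
  infinity at the origin, so nothing is required there; for \<open>\<alpha> = 1\<close> it is 1 everywhere (this is
  split off because \<open>0 powr 0 = 0\<close>).\<close>

definition hessian_growth :: "real \<Rightarrow> (real^'n \<Rightarrow> real) \<Rightarrow> (real^'n \<Rightarrow> real^'n^'n) \<Rightarrow> bool" where
  "hessian_growth \<alpha> f D2f \<longleftrightarrow>
     (\<exists>C>0. \<forall>x. (x \<noteq> 0 \<or> \<alpha> = 1) \<longrightarrow>
        1 / f x * norm (D2f x) \<le>
          C * (norm x powr (2 * \<alpha>) + (if \<alpha> = 1 then 1 else 1 / norm x powr (1 - \<alpha>))))"

definition symmetric_positive_definite :: "real^'n^'n \<Rightarrow> bool" where
  "symmetric_positive_definite A \<longleftrightarrow> transpose A = A \<and> (\<forall>v. v \<noteq> 0 \<longrightarrow> 0 < v \<bullet> (A *v v))"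

definition unique_global_minimizer :: "('v \<Rightarrow> real) \<Rightarrow> 'v \<Rightarrow> bool" where
  "unique_global_minimizer f x \<longleftrightarrow>
     is_arg_min f (\<lambda>_. True) x \<and> (\<forall>y. is_arg_min f (\<lambda>_. True) y \<longrightarrow> y = x)"


section \<open>The function Q and its quantized version\<close>

text \<open>\<open>Q_fun M F p X\<close> is the function \<open>Q\<close>. Replacing \<open>X\<close> by a Voronoi quantization \<open>Xh\<close> in the three
  definitions gives the quantized function, its gradient and its Hessian. (The expectation of a
  quantized expression is a finite sum, since \<open>Xh\<close> has finitely many values.)\<close>

definition Q_fun :: "'a measure \<Rightarrow> (real^'n \<Rightarrow> real) \<Rightarrow> (real^'n \<Rightarrow> real) \<Rightarrow> ('a \<Rightarrow> real^'n)
    \<Rightarrow> real^'n \<Rightarrow> real" where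
  "Q_fun M F p Y \<theta> = (\<integral>\<omega>. (F (Y \<omega>))\<^sup>2 * (p (Y \<omega>) / p (Y \<omega> - \<theta>)) \<partial>M)"

definition DQ_fun :: "'a measure \<Rightarrow> (real^'n \<Rightarrow> real) \<Rightarrow> (real^'n \<Rightarrow> real) \<Rightarrow> (real^'n \<Rightarrow> real^'n)
    \<Rightarrow> ('a \<Rightarrow> real^'n) \<Rightarrow> real^'n \<Rightarrow> real^'n" where
  "DQ_fun M F p Dp Y \<theta> =
     (\<integral>\<omega>. ((F (Y \<omega>))\<^sup>2 * (p (Y \<omega>) / (p (Y \<omega> - \<theta>))\<^sup>2)) *\<^sub>R Dp (Y \<omega> - \<theta>) \<partial>M)"

definition outer :: "real^'n \<Rightarrow> real^'n \<Rightarrow> real^'n^'n" where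
  "outer u v = (\<chi> i j. u $ i * v $ j)"

definition D2Q_fun :: "'a measure \<Rightarrow> (real^'n \<Rightarrow> real) \<Rightarrow> (real^'n \<Rightarrow> real) \<Rightarrow> (real^'n \<Rightarrow> real^'n)
    \<Rightarrow> (real^'n \<Rightarrow> real^'n^'n) \<Rightarrow> ('a \<Rightarrow> real^'n) \<Rightarrow> real^'n \<Rightarrow> real^'n^'n" where
  "D2Q_fun M F p Dp D2p Y \<theta> =
     (\<integral>\<omega>. ((F (Y \<omega>))\<^sup>2 * (p (Y \<omega>) / p (Y \<omega> - \<theta>))) *\<^sub>R
          ((2 / (p (Y \<omega> - \<theta>))\<^sup>2) *\<^sub>R outer (Dp (Y \<omega> - \<theta>)) (Dp (Y \<omega> - \<theta>))
           - (1 / p (Y \<omega> - \<theta>)) *\<^sub>R D2p (Y \<omega> - \<theta>)) \<partial>M)"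


section \<open>Quantization\<close>

definition L2norm :: "'a measure \<Rightarrow> ('a \<Rightarrow> 'v::real_normed_vector) \<Rightarrow> real" where
  "L2norm M Y = sqrt (\<integral>\<omega>. (norm (Y \<omega>))\<^sup>2 \<partial>M)"

text \<open>An \<open>N\<close>-tuple of points is a function on \<open>nat\<close>, of which only the values at \<open>1, \<dots>, N\<close> matter.\<close>

definition nearest_neighbour_projection ::
  "nat \<Rightarrow> (nat \<Rightarrow> real^'n) \<Rightarrow> (real^'n \<Rightarrow> real^'n) \<Rightarrow> bool" where
  "nearest_neighbour_projection N x Pr \<longleftrightarrow>
     Pr \<in> borel_measurable borel \<and>
     (\<forall>\<xi>. Pr \<xi> \<in> x ` {1..N} \<and> (\<forall>i\<in>{1..N}. norm (\<xi> - Pr \<xi>) \<le> norm (\<xi> - x i)))"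

definition quantization_error :: "'a measure \<Rightarrow> ('a \<Rightarrow> real^'n) \<Rightarrow> nat \<Rightarrow> (nat \<Rightarrow> real^'n) \<Rightarrow> real" where
  "quantization_error M X N y = L2norm M (\<lambda>\<omega>. Min ((\<lambda>i. norm (X \<omega> - y i)) ` {1..N}))"

definition L2_optimal :: "'a measure \<Rightarrow> ('a \<Rightarrow> real^'n) \<Rightarrow> nat \<Rightarrow> (nat \<Rightarrow> real^'n) \<Rightarrow> bool" where
  "L2_optimal M X N x \<longleftrightarrow> is_arg_min (quantization_error M X N) (\<lambda>_. True) x"

text \<open>The library provides conditional expectations of real random variables, so the condition
  \<open>E[X | Xh] = Xh\<close> is stated componentwise, given the sigma-algebra generated by \<open>Xh = Pr \<circ> X\<close>. The
  Voronoi cells are the sets \<open>Pr -` {x i}\<close>.\<close>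

definition stationary_quantizer ::
  "'a measure \<Rightarrow> ('a \<Rightarrow> real^'n) \<Rightarrow> nat \<Rightarrow> (nat \<Rightarrow> real^'n) \<Rightarrow> (real^'n \<Rightarrow> real^'n) \<Rightarrow> bool" where
  "stationary_quantizer M X N x Pr \<longleftrightarrow>
     inj_on x {1..N} \<and>
     measure M {\<omega> \<in> space M. X \<omega> \<in> (\<Union>i\<in>{1..N}. frontier (Pr -` {x i}))} = 0 \<and>
     (\<forall>k. AE \<omega> in M.
        real_cond_exp M (vimage_algebra (space M) (Pr \<circ> X) borel) (\<lambda>\<omega>. X \<omega> $ k) \<omega>
          = (Pr \<circ> X) \<omega> $ k)"

end

theory Submission
  imports Defs
begin

text \<open>Write \<open>g = ln p\<close>, so that \<open>Q \<theta> = E (F\<^sup>2(X) exp (g X - g (X - \<theta>)))\<close> is an average of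
  exponentials of convex functions. Applying the tangent inequality for \<open>g\<close> at a midpoint \<open>m\<close>, with
  \<open>exp s + exp (- s) \<ge> 2 + s\<^sup>2\<close>, gives
  \<open>Q (m - d) + Q (m + d) - 2 Q m \<ge> E (F\<^sup>2(X) p(X) / p(X - m) (D g (X - m) \<bullet> d)\<^sup>2)\<close>. By strict concavity
  the right-hand side is positive for \<open>d \<noteq> 0\<close>, and by compactness \<open>Q\<close> grows quadratically around its
  minimizer; no derivative of \<open>Q\<close> is needed. The gradient in \<open>\<theta>\<close> of the integrand is \<open>\<alpha>\<close>-Hoelder in \<open>X\<close>
  up to an exponential weight, hence \<open>Q - Q\<^sub>N\<close> is Lipschitz near the minimizer with a constant
  \<open>O(\<epsilon>\<^sub>N powr \<alpha>)\<close>, where \<open>\<epsilon>\<^sub>N\<close> is the quantization error. For the convex function \<open>Q\<^sub>N\<close> this forces the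
  minimizer to within \<open>O(\<epsilon>\<^sub>N powr \<alpha>)\<close> of the minimizer of \<open>Q\<close>.\<close>

section \<open>Newton iteration and finitely supported expectations\<close>

text \<open>Quadratic growth of \<open>Q\<close> together with a bound of order \<epsilon>^\<alpha>
  on the values of \<open>Q\<close> minus its quantized version would only give the rate
  \<epsilon>^(\<alpha>/2). Comparing increments in \<theta> instead of values leaves a factor
  |\<theta> - \<theta>s| in the error, where \<theta>s is the minimizer, and this factor cancels one
  power of the quadratic lower bound. Tails are the other obstacle: \<open>- g\<close> may grow like
  |x|^(1+\<alpha>), so \<open>exp (- g (X - \<theta>))\<close> alone need not be controlled by
  exponential moments. The Hoelder bound on \<open>Dp / p\<close> makes
  \<open>g y - g (y - \<theta>)\<close> Lipschitz in y, and its exponential is then dominated by exp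
  (c |y|). The quantized variable inherits these moments from X through |Xh| \<le> 2 |X| + B with B
  independent of N. The Newton part is separate: for fixed N all expectations are finite sums, and
  the iteration contracts near a zero of the gradient at which the Hessian is continuous and
  invertible.\<close>

lemma newton_iteration_converges:
  fixes G :: "real^'n \<Rightarrow> real^'n" and H :: "real^'n \<Rightarrow> real^'n^'n"
  assumes deriv: "(G has_derivative (\<lambda>h. H z *v h)) (at z)"
    and zero: "G z = 0" and cont: "isCont H z" and inv: "invertible (H z)"
  shows "\<exists>\<eta>>0. \<forall>\<theta>. norm (\<theta> 0 - z) \<le> \<eta> \<longrightarrow>
           (\<forall>n. \<theta> (Suc n) = \<theta> n - matrix_inv (H (\<theta> n)) *v G (\<theta> n)) \<longrightarrow> \<theta> \<longlonglongrightarrow> z"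
proof -
  have lin: "bounded_bilinear (\<lambda>(A::real^'n^'n) v. A *v v)"
    by (intro bilinear_conv_bounded_bilinear[THEN iffD1])
       (auto simp: bilinear_def linear_iff matrix_vector_right_distrib matrix_vector_mult_add_rdistrib
          matrix_vector_mult_scaleR scaleR_matrix_vector_assoc)
  obtain K where K: "0 < K" "\<And>(A::real^'n^'n) v. norm (A *v v) \<le> norm A * norm v * K"
    using bounded_bilinear.pos_bounded[OF lin] by blast
  have "inj ((*v) (H z))"
    using inv matrix_left_invertible_injective[of "H z"] by (auto simp: invertible_def)
  then obtain c where c: "0 < c" "\<And>v. c * norm v \<le> norm (H z *v v)"
    using linear_inj_bounded_below_pos[of "(*v) (H z)"] by (metis matrix_vector_mul_linear)
  \<comment> \<open>\<open>K\<close> bounds the bilinear matrix-vector product, so this closeness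
    costs c/4 of the lower bound \<open>c\<close> and leaves 3c/4. With the remainder c/8 below, the
    error shrinks by the factor (c/4 + c/8) / (3c/4) = 1/2.\<close>
  have "\<exists>d>0. \<forall>\<theta>. norm (\<theta> - z) < d \<longrightarrow> norm (H \<theta> - H z) < c / (4 * K)"
    using cont c K by (force simp: continuous_at_eps_delta dist_norm)
  then obtain d1 where d1: "d1 > 0" "\<And>\<theta>. norm (\<theta> - z) < d1 \<Longrightarrow> norm (H \<theta> - H z) < c / (4 * K)"
    by blast
  have "\<exists>d>0. \<forall>\<theta>. norm (\<theta> - z) < d \<longrightarrow>
      norm (G \<theta> - G z - H z *v (\<theta> - z)) \<le> c / 8 * norm (\<theta> - z)"
    using deriv c unfolding has_derivative_at_alt by (metis divide_pos_pos zero_less_numeral)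
  then obtain d2 where d2: "d2 > 0" "\<And>\<theta>. norm (\<theta> - z) < d2 \<Longrightarrow>
      norm (G \<theta> - H z *v (\<theta> - z)) \<le> c / 8 * norm (\<theta> - z)"
    using zero by auto
  have below: "3 * c / 4 * norm v \<le> norm (H \<theta> *v v)" if "norm (\<theta> - z) < d1" for \<theta> v
  proof -
    have "norm ((H \<theta> - H z) *v v) \<le> norm (H \<theta> - H z) * norm v * K" by (rule K)
    also have "\<dots> \<le> c / (4 * K) * norm v * K"
      using d1(2)[OF that] K by (intro mult_right_mono) auto
    finally have "norm ((H \<theta> - H z) *v v) \<le> c / 4 * norm v" using K by simp
    moreover have "H z *v v = H \<theta> *v v - (H \<theta> - H z) *v v"
      by (simp add: matrix_vector_mult_diff_rdistrib)
    ultimately have "norm (H z *v v) \<le> norm (H \<theta> *v v) + c / 4 * norm v"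
      by (metis add_left_mono norm_triangle_ineq4 order_trans)
    then show ?thesis using c(2)[of v] by linarith
  qed
  have contract: "norm (\<theta> - matrix_inv (H \<theta>) *v G \<theta> - z) \<le> norm (\<theta> - z) / 2"
    if "norm (\<theta> - z) < min d1 d2" for \<theta>
  proof -
    have "inj ((*v) (H \<theta>))"
    proof (rule injI)
      fix u v assume "H \<theta> *v u = H \<theta> *v v"
      then have "H \<theta> *v (u - v) = 0" by (simp add: matrix_vector_mult_diff_distrib)
      then show "u = v" using below[of \<theta> "u - v"] that c
        by (simp add: mult_le_0_iff)
    qed
    then have "invertible (H \<theta>)"
      by (simp add: invertible_left_inverse matrix_left_invertible_injective)
    then have I: "H \<theta> ** matrix_inv (H \<theta>) = mat 1"
      unfolding matrix_inv_def invertible_def by (rule someI2_ex) auto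
    let ?v = "\<theta> - matrix_inv (H \<theta>) *v G \<theta> - z"
    \<comment> \<open>Multiplying the new error by \<open>H \<theta>\<close> removes the inverse;
      what remains is the variation of \<open>H\<close> and the first-order remainder of
      \<open>G\<close> at \<open>z\<close>.\<close>
    have "H \<theta> *v ?v = H \<theta> *v (\<theta> - z) - (H \<theta> ** matrix_inv (H \<theta>)) *v G \<theta>"
      by (simp add: matrix_vector_mult_diff_distrib matrix_vector_mul_assoc algebra_simps)
    also have "\<dots> = (H \<theta> - H z) *v (\<theta> - z) - (G \<theta> - H z *v (\<theta> - z))"
      by (simp add: I matrix_vector_mult_diff_rdistrib)
    finally have "norm (H \<theta> *v ?v) \<le> norm ((H \<theta> - H z) *v (\<theta> - z)) + norm (G \<theta> - H z *v (\<theta> - z))"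
      by (metis norm_triangle_ineq4)
    also have "norm ((H \<theta> - H z) *v (\<theta> - z)) \<le> norm (H \<theta> - H z) * norm (\<theta> - z) * K" by (rule K)
    also have "\<dots> \<le> c / (4 * K) * norm (\<theta> - z) * K"
      using d1(2)[of \<theta>] that K by (intro mult_right_mono) auto
    also have "\<dots> = c / 4 * norm (\<theta> - z)" using K by simp
    finally have "norm (H \<theta> *v ?v) \<le> 3 * c / 8 * norm (\<theta> - z)"
      using d2(2)[of \<theta>] that by auto
    with below[of \<theta> ?v] that have "3 * c / 4 * norm ?v \<le> 3 * c / 8 * norm (\<theta> - z)" by auto
    with c show ?thesis by (simp add: field_simps)
  qed
  show ?thesis
  \<comment> \<open>Halving puts the closed ball of starting points inside the open ball on which
    the contraction holds.\<close>
  proof (intro exI[of _ "min d1 d2 / 2"] conjI allI impI)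
    show "0 < min d1 d2 / 2" using d1 d2 by simp
    fix \<theta> assume 0: "norm (\<theta> 0 - z) \<le> min d1 d2 / 2"
      and step: "\<forall>n. \<theta> (Suc n) = \<theta> n - matrix_inv (H (\<theta> n)) *v G (\<theta> n)"
    have bd: "norm (\<theta> n - z) \<le> (1/2)^n * (min d1 d2 / 2)" for n
    proof (induction n)
      case (Suc n)
      have "(1/2)^n * (min d1 d2 / 2) \<le> 1 * (min d1 d2 / 2)"
        using d1 d2 by (intro mult_right_mono power_le_one) auto
      also have "\<dots> < min d1 d2" using d1 d2 by auto
      finally have "norm (\<theta> n - z) < min d1 d2" using Suc by linarith
      from contract[OF this] Suc step show ?case by simp
    qed (use 0 in simp)
    have "(\<lambda>n. (1/2)^n * (min d1 d2 / 2)) \<longlonglongrightarrow> 0"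
      by (intro tendsto_mult_left_zero LIMSEQ_power_zero) auto
    then have "(\<lambda>n. norm (\<theta> n - z)) \<longlonglongrightarrow> 0"
      by (rule Lim_null_comparison[rotated]) (use bd in auto)
    then show "\<theta> \<longlonglongrightarrow> z" by (simp add: LIM_zero_iff tendsto_norm_zero_iff)
  qed
qed

text \<open>A function of a variable with finitely many values is a finite combination of indicators
  of events. This turns the quantized functions into finite sums that can be differentiated term by
  term.\<close>

lemma integral_finite_range:
  fixes f :: "'b::t1_space \<Rightarrow> 'c::{banach,second_countable_topology}"
  assumes "finite_measure M" and Y: "Y \<in> borel_measurable M"
    and S: "finite S" "\<And>\<omega>. \<omega> \<in> space M \<Longrightarrow> Y \<omega> \<in> S"
  shows "integrable M (\<lambda>\<omega>. f (Y \<omega>))"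
    and "(\<integral>\<omega>. f (Y \<omega>) \<partial>M) = (\<Sum>s\<in>S. measure M (Y -` {s} \<inter> space M) *\<^sub>R f s)"
proof -
  interpret finite_measure M by fact
  have eq: "f (Y \<omega>) = (\<Sum>s\<in>S. indicator (Y -` {s} \<inter> space M) \<omega> *\<^sub>R f s)" if "\<omega> \<in> space M" for \<omega>
  proof -
    have "(\<Sum>s\<in>S. indicator (Y -` {s} \<inter> space M) \<omega> *\<^sub>R f s) = (\<Sum>s\<in>S. if s = Y \<omega> then f s else 0)"
      using that by (intro sum.cong) (auto simp: indicator_def)
    then show ?thesis using S that by simp
  qed
  have [simp]: "Y -` {s} \<inter> space M \<in> sets M" for s
    using Y by (rule measurable_sets) simp
  have int: "has_bochner_integral M (\<lambda>\<omega>. \<Sum>s\<in>S. indicator (Y -` {s} \<inter> space M) \<omega> *\<^sub>R f s)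
     (\<Sum>s\<in>S. measure M (Y -` {s} \<inter> space M) *\<^sub>R f s)"
    by (intro has_bochner_integral_sum has_bochner_integral_scaleR_left
         has_bochner_integral_real_indicator) (auto simp: less_top[symmetric])
  then have "has_bochner_integral M (\<lambda>\<omega>. f (Y \<omega>)) (\<Sum>s\<in>S. measure M (Y -` {s} \<inter> space M) *\<^sub>R f s)"
    by (rule has_bochner_integral_cong[THEN iffD1, rotated -1]) (auto simp: eq)
  then show "integrable M (\<lambda>\<omega>. f (Y \<omega>))"
    and "(\<integral>\<omega>. f (Y \<omega>) \<partial>M) = (\<Sum>s\<in>S. measure M (Y -` {s} \<inter> space M) *\<^sub>R f s)"
    by (auto simp: has_bochner_integral_iff)
qed

lemma outer_mult_vector: "outer u v *v h = (v \<bullet> h) *\<^sub>R u"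
  by (simp add: vec_eq_iff outer_def matrix_vector_mult_def inner_vec_def sum_distrib_left
      sum_distrib_right algebra_simps)

lemma has_derivative_reflect:
  assumes "(f has_derivative f') (at (y - \<theta>))"
  shows "((\<lambda>\<theta>. f (y - \<theta>)) has_derivative (\<lambda>h. - f' h)) (at \<theta>)"
proof -
  have "((\<lambda>\<theta>. f (y - \<theta>)) has_derivative (\<lambda>h. f' (- h))) (at \<theta>)"
    by (rule has_derivative_compose[where g = f and f = "\<lambda>\<theta>. y - \<theta>"])
       (auto intro!: derivative_eq_intros assms)
  moreover have "f' (- h) = - f' h" for h
    using assms has_derivative_linear linear_neg by blast
  ultimately show ?thesis by simp
qed

context
  fixes p F :: "real^'n \<Rightarrow> real" and Dp :: "real^'n \<Rightarrow> real^'n" and D2p :: "real^'n \<Rightarrow> real^'n^'n"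
    and M :: "'a measure" and Y :: "'a \<Rightarrow> real^'n" and S :: "(real^'n) set"
  assumes p: "\<And>y. 0 < p y" and diff: "twice_differentiable_with p Dp D2p"
    and M: "finite_measure M" and Y: "Y \<in> borel_measurable M"
    and S: "finite S" "\<And>\<omega>. \<omega> \<in> space M \<Longrightarrow> Y \<omega> \<in> S"
begin

lemma Q_fun_has_gradient: "GDERIV (Q_fun M F p Y) \<theta> :> DQ_fun M F p Dp Y \<theta>"
proof -
  let ?w = "\<lambda>y. measure M (Y -` {y} \<inter> space M)"
  have "((\<lambda>\<theta>. (F y)\<^sup>2 * (p y / p (y - \<theta>))) has_derivative
     (\<lambda>h. h \<bullet> (((F y)\<^sup>2 * (p y / (p (y - \<theta>))\<^sup>2)) *\<^sub>R Dp (y - \<theta>)))) (at \<theta>)" for y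
  proof -
    have "(p has_derivative (\<lambda>h. h \<bullet> Dp (y - \<theta>))) (at (y - \<theta>))"
      using diff by (auto simp: twice_differentiable_with_def gderiv_def)
    from has_derivative_reflect[OF this] show ?thesis
      using p[of "y - \<theta>"] by (auto intro!: derivative_eq_intros simp: power2_eq_square divide_inverse)
  qed
  note deriv = this
  have Q: "Q_fun M F p Y = (\<lambda>\<theta>. \<Sum>y\<in>S. ?w y * ((F y)\<^sup>2 * (p y / p (y - \<theta>))))"
    unfolding Q_fun_def
    using integral_finite_range(2)[OF M Y S, where f = "\<lambda>y. (F y)\<^sup>2 * (p y / p (y - _))"] by simp
  have DQ: "DQ_fun M F p Dp Y \<theta> = (\<Sum>y\<in>S. ?w y *\<^sub>R (((F y)\<^sup>2 * (p y / (p (y - \<theta>))\<^sup>2)) *\<^sub>R Dp (y - \<theta>)))"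
    unfolding DQ_fun_def by (rule integral_finite_range(2)[OF M Y S])
  show ?thesis
    unfolding Q DQ gderiv_def inner_sum_right inner_scaleR_right[of _ "?w _"]
    by (intro has_derivative_sum has_derivative_mult_right deriv)
qed

lemma DQ_fun_has_derivative:
  "(DQ_fun M F p Dp Y has_derivative (\<lambda>h. D2Q_fun M F p Dp D2p Y \<theta> *v h)) (at \<theta>)"
proof -
  let ?w = "\<lambda>y. measure M (Y -` {y} \<inter> space M)"
  let ?B = "\<lambda>y. ((F y)\<^sup>2 * (p y / p (y - \<theta>))) *\<^sub>R ((2 / (p (y - \<theta>))\<^sup>2) *\<^sub>R
     outer (Dp (y - \<theta>)) (Dp (y - \<theta>)) - (1 / p (y - \<theta>)) *\<^sub>R D2p (y - \<theta>))"
  have *: "((\<lambda>\<theta>. ((F y)\<^sup>2 * (p y / (p (y - \<theta>))\<^sup>2)) *\<^sub>R Dp (y - \<theta>)) has_derivative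
     (\<lambda>h. ?B y *v h)) (at \<theta>)" for y
  proof -
    have 1: "(p has_derivative (\<lambda>h. h \<bullet> Dp (y - \<theta>))) (at (y - \<theta>))"
      "(Dp has_derivative (\<lambda>h. D2p (y - \<theta>) *v h)) (at (y - \<theta>))"
      using diff by (auto simp: twice_differentiable_with_def gderiv_def)
    note 2 = has_derivative_reflect[OF 1(1)] has_derivative_reflect[OF 1(2)]
    let ?q = "p (y - \<theta>)" and ?c = "(F y)\<^sup>2 * p y"
    have "((\<lambda>\<theta>. (F y)\<^sup>2 * (p y / (p (y - \<theta>))\<^sup>2)) has_derivative
        (\<lambda>h. 2 * ?c / ?q ^ 3 * (h \<bullet> Dp (y - \<theta>)))) (at \<theta>)"
      using 2(1) p[of "y - \<theta>"]
      by (auto intro!: derivative_eq_intros simp: field_simps power2_eq_square power3_eq_cube)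
    from has_derivative_scaleR[OF this 2(2)] show ?thesis
    proof (rule has_derivative_eq_rhs, intro ext)
      fix h
      \<comment> \<open>Exposes the factor \<open>?c / ?q\<close> of \<open>?B\<close>. The rank-one
        term comes from differentiating 1/q^2, the Hessian from differentiating \<open>Dp\<close>,
        with the minus sign of the reflection.\<close>
      have "?c / ?q\<^sup>2 = ?c / ?q * (1 / ?q)" "2 * ?c / ?q ^ 3 = ?c / ?q * (2 / ?q\<^sup>2)"
        by (simp_all add: power2_eq_square power3_eq_cube mult_ac)
      then show "((F y)\<^sup>2 * (p y / ?q\<^sup>2)) *\<^sub>R - (D2p (y - \<theta>) *v h) +
          (2 * ?c / ?q ^ 3 * (h \<bullet> Dp (y - \<theta>))) *\<^sub>R Dp (y - \<theta>) = ?B y *v h"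
        by (simp add: matrix_vector_mult_diff_rdistrib outer_mult_vector inner_commute
          scaleR_matrix_vector_assoc[symmetric] scaleR_diff_right)
    qed
  qed
  have sum: "(\<Sum>s\<in>S. B s) *v h = (\<Sum>s\<in>S. B s *v h)" for B :: "real^'n \<Rightarrow> real^'n^'n" and h
    by (induction S rule: infinite_finite_induct) (auto simp: matrix_vector_mult_add_rdistrib)
  have DQ: "DQ_fun M F p Dp Y = (\<lambda>\<theta>. \<Sum>y\<in>S. ?w y *\<^sub>R (((F y)\<^sup>2 * (p y / (p (y - \<theta>))\<^sup>2)) *\<^sub>R Dp (y - \<theta>)))"
    unfolding DQ_fun_def
    using integral_finite_range(2)[OF M Y S, where f = "\<lambda>y. ((F y)\<^sup>2 * (p y / (p (y - _))\<^sup>2)) *\<^sub>R Dp (y - _)"]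
    by simp
  have D2Q: "D2Q_fun M F p Dp D2p Y \<theta> = (\<Sum>y\<in>S. ?w y *\<^sub>R ?B y)"
    unfolding D2Q_fun_def by (rule integral_finite_range(2)[OF M Y S])
  show ?thesis
    unfolding DQ D2Q sum scaleR_matrix_vector_assoc[of "?w _", symmetric]
    by (intro has_derivative_sum has_derivative_scaleR_right *)
qed

lemma continuous_on_D2Q_fun:
  assumes "continuous_on UNIV D2p"
  shows "continuous_on UNIV (D2Q_fun M F p Dp D2p Y)"
proof -
  have [continuous_intros]: "continuous_on UNIV (\<lambda>\<theta>. f (y - \<theta>))"
    if "continuous_on UNIV f" for f :: "real^'n \<Rightarrow> 'b::topological_space" and y
    by (rule continuous_on_compose2[OF that]) (auto intro!: continuous_intros)
  have "continuous_on UNIV p" "continuous_on UNIV Dp"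
    using diff by (auto simp: twice_differentiable_with_def gderiv_def continuous_on_eq_continuous_at
        intro: has_derivative_continuous)
  moreover have "D2Q_fun M F p Dp D2p Y = (\<lambda>\<theta>. \<Sum>y\<in>S. measure M (Y -` {y} \<inter> space M) *\<^sub>R
      (((F y)\<^sup>2 * (p y / p (y - \<theta>))) *\<^sub>R ((2 / (p (y - \<theta>))\<^sup>2) *\<^sub>R
     outer (Dp (y - \<theta>)) (Dp (y - \<theta>)) - (1 / p (y - \<theta>)) *\<^sub>R D2p (y - \<theta>))))"
    unfolding D2Q_fun_def by (rule ext, rule integral_finite_range(2)[OF M Y S])
  ultimately show ?thesis
    using assms p unfolding outer_def
    by (simp only:) (intro continuous_intros; simp add: less_imp_neq[symmetric])
qed

end

section \<open>Log-concave functions and exponentially weighted Hoelder families\<close>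

text \<open>The set where p is positive is convex and of full measure. It is dense, because the
  complement of its closure is open and null, and a dense convex set in finite dimension is the
  whole space. Positivity at every point makes \<open>ln p\<close> and the quotients by p meaningful
  everywhere.\<close>

lemma strictly_log_concave_pos:
  fixes p :: "'v::euclidean_space \<Rightarrow> real"
  assumes "strictly_log_concave p" and ae: "AE \<xi> in lborel. 0 < p \<xi>"
  shows "0 < p y"
proof -
  let ?S = "{y. 0 < p y}"
  have "convex ?S"
    unfolding convex_alt
  proof (intro ballI allI impI)
    fix x y and t :: real assume "x \<in> ?S" "y \<in> ?S" "0 \<le> t \<and> t \<le> 1"
    then show "(1 - t) *\<^sub>R x + t *\<^sub>R y \<in> ?S"
      using assms(1) unfolding strictly_log_concave_def
      by (cases "t = 0 \<or> t = 1 \<or> x = y") (auto simp: scaleR_left.diff[symmetric] algebra_simps)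
  qed
  moreover have "- closure ?S = {}"
  proof (rule ccontr)
    assume ne: "- closure ?S \<noteq> {}"
    obtain N where N: "{y. \<not> 0 < p y} \<subseteq> N" "N \<in> null_sets lborel"
      using ae by (auto elim!: AE_E simp: null_sets_def)
    have "- closure ?S \<subseteq> N"
      using closure_subset[of ?S] N(1) by auto
    moreover have "negligible N"
      using N(2) by (simp add: negligible_iff_null_sets null_sets_completionI)
    ultimately have "negligible (- closure ?S)" by (rule negligible_subset[rotated])
    with ne show False using open_not_negligible[of "- closure ?S"] by auto
  qed
  then have "closure ?S = UNIV" by auto
  ultimately have "interior ?S = UNIV"
    by (metis convex_interior_closure interior_UNIV)
  then show ?thesis using interior_subset[of ?S] by auto
qed

text \<open>Restriction to the line through \<open>x\<close> and \<open>y\<close> reduces this to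
  the one-dimensional tangent inequality, taken at parameter 0 and evaluated at parameter 1.\<close>

lemma concave_on_le_tangent:
  fixes g :: "'v::euclidean_space \<Rightarrow> real"
  assumes "concave_on UNIV g" and "GDERIV g x :> d"
  shows "g y \<le> g x + d \<bullet> (y - x)"
proof -
  let ?\<phi> = "\<lambda>t. - g (x + t *\<^sub>R (y - x))"
  have c: "convex_on UNIV (\<lambda>z. - g z)" using assms(1) by (simp add: concave_on_def)
  have cv: "convex_on UNIV ?\<phi>"
  proof (rule convex_onI)
    fix t s u :: real assume t: "0 < t" "t < 1"
    have "x + ((1 - t) *\<^sub>R s + t *\<^sub>R u) *\<^sub>R (y - x)
       = (1 - t) *\<^sub>R (x + s *\<^sub>R (y - x)) + t *\<^sub>R (x + u *\<^sub>R (y - x))"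
      by (simp add: algebra_simps)
    then show "?\<phi> ((1 - t) *\<^sub>R s + t *\<^sub>R u) \<le> (1 - t) * ?\<phi> s + t * ?\<phi> u"
      using convex_onD[OF c, of t "x + s *\<^sub>R (y - x)" "x + u *\<^sub>R (y - x)"] t by simp
  qed simp
  have "(g has_derivative (\<lambda>h. h \<bullet> d)) (at (x + 0 *\<^sub>R (y - x)))"
    using assms(2) by (simp add: gderiv_def)
  then have "((\<lambda>t::real. g (x + t *\<^sub>R (y - x))) has_derivative (\<lambda>t. (t *\<^sub>R (y - x)) \<bullet> d)) (at 0)"
    by (rule has_derivative_compose[where f = "\<lambda>t. x + t *\<^sub>R (y - x)", rotated])
       (auto intro!: derivative_eq_intros)
  then have "(?\<phi> has_real_derivative - ((y - x) \<bullet> d)) (at 0)"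
    unfolding has_field_derivative_def
    by (auto intro!: derivative_eq_intros simp: fun_eq_iff algebra_simps)
  then have "?\<phi> 1 - ?\<phi> 0 \<ge> - ((y - x) \<bullet> d) * (1 - 0)"
    by (intro convex_on_imp_above_tangent[OF cv]) auto
  then show ?thesis by (simp add: inner_commute)
qed

text \<open>An exponential weight, unlike a polynomial one, needs no bookkeeping of degrees: the class is
  closed under products and contains every Lipschitz function and its exponential.\<close>

definition exp_hoelder ::
    "real \<Rightarrow> 'i set \<Rightarrow> ('i \<Rightarrow> 'v::real_normed_vector \<Rightarrow> 'w::real_normed_vector) \<Rightarrow> bool" where
  "exp_hoelder \<alpha> I f \<longleftrightarrow> (\<exists>C\<ge>0. \<forall>i\<in>I. \<forall>x y. norm (f i x) \<le> C * exp (C * norm x) \<and>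
     norm (f i x - f i y) \<le> C * exp (C * (norm x + norm y)) * norm (x - y) powr \<alpha>)"

lemma exp_hoelderI:
  fixes f :: "'i \<Rightarrow> 'v::real_normed_vector \<Rightarrow> 'w::real_normed_vector"
  assumes "\<And>i x. i \<in> I \<Longrightarrow> norm (f i x) \<le> A * exp (B * norm x)"
    and "\<And>i x y. i \<in> I \<Longrightarrow>
      norm (f i x - f i y) \<le> A * exp (B * (norm x + norm y)) * norm (x - y) powr \<alpha>"
  shows "exp_hoelder \<alpha> I f"
proof -
  \<comment> \<open>One constant serves as factor and as exponent; the absolute values allow
    \<open>A\<close> and \<open>B\<close> of any sign.\<close>
  define C where "C = \<bar>A\<bar> + \<bar>B\<bar>"
  have C: "A * exp (B * r) \<le> C * exp (C * r)" if "0 \<le> r" for r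
    using that by (intro mult_mono) (auto simp: C_def intro!: mult_right_mono)
  show ?thesis unfolding exp_hoelder_def
  proof (intro exI[of _ C] conjI ballI allI)
    fix i x y assume i: "i \<in> I"
    show "norm (f i x) \<le> C * exp (C * norm x)"
      using assms(1)[OF i, of x] C[of "norm x"] by simp
    have "norm (f i x - f i y) \<le> A * exp (B * (norm x + norm y)) * norm (x - y) powr \<alpha>"
      by (rule assms(2)[OF i])
    also have "\<dots> \<le> C * exp (C * (norm x + norm y)) * norm (x - y) powr \<alpha>"
      by (intro mult_right_mono C) auto
    finally show "norm (f i x - f i y) \<le> C * exp (C * (norm x + norm y)) * norm (x - y) powr \<alpha>" .
  qed (simp add: C_def)
qed

lemma powr_le_one_plus: "0 \<le> r \<Longrightarrow> 0 < \<alpha> \<Longrightarrow> \<alpha> \<le> 1 \<Longrightarrow> r powr \<alpha> \<le> 1 + (r::real)"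
  by (cases "r \<le> 1") (use powr_le1[of \<alpha> r] powr_mono[of \<alpha> 1 r] in auto)

text \<open>Split r = r^(1-\<alpha>) r^\<alpha> and use r^(1-\<alpha>) \<le> 1 + r: the surplus
  power at large distances goes into the exponential weight. This is how Lipschitz functions enter
  the \<alpha>-Hoelder class.\<close>

lemma le_exp_mult_powr:
  fixes x y :: "'v::real_normed_vector"
  assumes "0 < \<alpha>" "\<alpha> \<le> 1"
  shows "norm (x - y) \<le> exp (norm x + norm y) * norm (x - y) powr \<alpha>"
proof (cases "x = y")
  case False
  let ?r = "norm (x - y)"
  have "?r powr (1 - \<alpha>) \<le> 1 + ?r"
    using assms powr_le_one_plus[of ?r "1 - \<alpha>"] False by (cases "\<alpha> = 1") auto
  also have "\<dots> \<le> 1 + (norm x + norm y)" using norm_triangle_ineq4[of x y] by simp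
  also have "\<dots> \<le> exp (norm x + norm y)" by (rule exp_ge_add_one_self)
  finally have "?r powr (1 - \<alpha>) * ?r powr \<alpha> \<le> exp (norm x + norm y) * ?r powr \<alpha>"
    by (rule mult_right_mono) simp
  with False show ?thesis by (simp add: powr_add[symmetric])
qed (use assms in simp)

lemma exp_hoelder_hoelder:
  fixes f :: "'i \<Rightarrow> 'v::real_normed_vector \<Rightarrow> 'w::real_normed_vector"
  assumes \<alpha>: "0 < \<alpha>" "\<alpha> \<le> 1" and "\<And>i. i \<in> I \<Longrightarrow> norm (f i 0) \<le> A"
    and h: "\<And>i x y. i \<in> I \<Longrightarrow> norm (f i x - f i y) \<le> K * norm (x - y) powr \<alpha>"
  shows "exp_hoelder \<alpha> I f"
proof (rule exp_hoelderI[where A = "\<bar>A\<bar> + \<bar>K\<bar>" and B = 1])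
  fix i x y assume i: "i \<in> I"
  have "norm (f i x) \<le> norm (f i 0) + norm (f i x - f i 0)"
    by (metis add_diff_cancel_left' diff_add_cancel norm_triangle_ineq add.commute)
  also have "\<dots> \<le> A + K * norm (x - 0) powr \<alpha>" by (intro add_mono assms i)
  also have "\<dots> \<le> \<bar>A\<bar> * 1 + \<bar>K\<bar> * norm x powr \<alpha>" by (intro add_mono) (auto intro: mult_right_mono)
  also have "\<dots> \<le> \<bar>A\<bar> * exp (norm x) + \<bar>K\<bar> * exp (norm x)"
    using powr_le_one_plus[of "norm x" \<alpha>] \<alpha> exp_ge_add_one_self[of "norm x"]
    by (intro add_mono mult_left_mono) (auto intro: order_trans)
  finally show "norm (f i x) \<le> (\<bar>A\<bar> + \<bar>K\<bar>) * exp (1 * norm x)" by (simp add: algebra_simps)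
  have "norm (f i x - f i y) \<le> K * norm (x - y) powr \<alpha>" by (rule h[OF i])
  also have "\<dots> \<le> ((\<bar>A\<bar> + \<bar>K\<bar>) * exp (1 * (norm x + norm y))) * norm (x - y) powr \<alpha>"
  proof (intro mult_right_mono)
    have "K \<le> (\<bar>A\<bar> + \<bar>K\<bar>) * 1" by simp
    also have "\<dots> \<le> (\<bar>A\<bar> + \<bar>K\<bar>) * exp (1 * (norm x + norm y))" by (intro mult_left_mono) auto
    finally show "K \<le> (\<bar>A\<bar> + \<bar>K\<bar>) * exp (1 * (norm x + norm y))" .
  qed auto
  finally show "norm (f i x - f i y) \<le> (\<bar>A\<bar> + \<bar>K\<bar>) * exp (1 * (norm x + norm y)) * norm (x - y) powr \<alpha>" .
qed

lemma exp_hoelder_lipschitz: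
  fixes f :: "'i \<Rightarrow> 'v::real_normed_vector \<Rightarrow> 'w::real_normed_vector"
  assumes \<alpha>: "0 < \<alpha>" "\<alpha> \<le> 1" and A: "\<And>i. i \<in> I \<Longrightarrow> norm (f i 0) \<le> A"
    and h: "\<And>i x y. i \<in> I \<Longrightarrow> norm (f i x - f i y) \<le> K * norm (x - y)"
  shows "exp_hoelder \<alpha> I f"
proof (rule exp_hoelderI[where A = "\<bar>A\<bar> + \<bar>K\<bar>" and B = 1])
  fix i x y assume i: "i \<in> I"
  have "norm (f i x) \<le> norm (f i 0) + norm (f i x - f i 0)"
    by (metis add_diff_cancel_left' diff_add_cancel norm_triangle_ineq add.commute)
  also have "\<dots> \<le> A + K * norm (x - 0)" by (intro add_mono assms i)
  also have "\<dots> \<le> \<bar>A\<bar> * 1 + \<bar>K\<bar> * norm x" by (intro add_mono) (auto intro: mult_right_mono)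
  also have "\<dots> \<le> \<bar>A\<bar> * exp (norm x) + \<bar>K\<bar> * exp (norm x)"
    by (intro add_mono mult_left_mono order_trans[OF _ exp_ge_add_one_self]) auto
  finally show "norm (f i x) \<le> (\<bar>A\<bar> + \<bar>K\<bar>) * exp (1 * norm x)" by (simp add: algebra_simps)
  have "norm (f i x - f i y) \<le> K * norm (x - y)" by (rule h[OF i])
  also have "\<dots> \<le> (\<bar>A\<bar> + \<bar>K\<bar>) * (exp (norm x + norm y) * norm (x - y) powr \<alpha>)"
    by (intro mult_mono le_exp_mult_powr \<alpha>) auto
  finally show "norm (f i x - f i y) \<le> (\<bar>A\<bar> + \<bar>K\<bar>) * exp (1 * (norm x + norm y)) * norm (x - y) powr \<alpha>"
    by simp
qed

lemma abs_exp_diff_le: "\<bar>exp a - exp b\<bar> \<le> exp (max a b) * \<bar>a - b\<bar>" for a b :: real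
proof -
  have *: "exp u - exp v \<le> exp u * (u - v)" for u v :: real
    using mult_left_mono[OF exp_ge_add_one_self[of "v - u"], of "exp u"]
    by (simp add: exp_add[symmetric] algebra_simps)
  show ?thesis using *[of a b] *[of b a] by (cases "a \<le> b") auto
qed

text \<open>A Lipschitz exponent grows at most linearly, so its exponential fits under the weight,
  and so does the factor \<open>exp (max a b)\<close> from the mean value estimate. A merely locally
  Lipschitz exponent could outgrow every such weight.\<close>

lemma exp_hoelder_exp_lipschitz:
  fixes f :: "'i \<Rightarrow> 'v::real_normed_vector \<Rightarrow> real"
  assumes \<alpha>: "0 < \<alpha>" "\<alpha> \<le> 1" and A: "\<And>i. i \<in> I \<Longrightarrow> \<bar>f i 0\<bar> \<le> A"
    and h: "\<And>i x y. i \<in> I \<Longrightarrow> \<bar>f i x - f i y\<bar> \<le> K * norm (x - y)" and K: "0 \<le> K"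
  shows "exp_hoelder \<alpha> I (\<lambda>i x. exp (f i x))"
\<comment> \<open>The exponent \<open>K\<close> comes from the growth of \<open>f\<close>, the
  additional 1 from \<open>le_exp_mult_powr\<close>.\<close>
proof (rule exp_hoelderI[where A = "exp A * (K + 1)" and B = "K + 1"])
  fix i x y assume i: "i \<in> I"
  have f: "f i x \<le> A + K * norm x" for x :: 'v
    using A[OF i] h[OF i, of x 0] by auto
  have "exp (f i x) \<le> exp (A + K * norm x)" using f by simp
  also have "\<dots> \<le> exp A * (K + 1) * exp ((K + 1) * norm x)"
    unfolding exp_add using K by (intro mult_mono) (auto simp: algebra_simps)
  finally show "norm (exp (f i x)) \<le> exp A * (K + 1) * exp ((K + 1) * norm x)" by simp
  have "f i x \<le> A + K * (norm x + norm y)" "f i y \<le> A + K * (norm x + norm y)"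
    using f[of x] f[of y] K by (auto simp: algebra_simps intro: order_trans)
  then have "exp (max (f i x) (f i y)) \<le> exp A * exp (K * (norm x + norm y))"
    by (simp add: exp_add[symmetric])
  from order_trans[OF abs_exp_diff_le mult_mono[OF this h[OF i, of x y]]]
  have "norm (exp (f i x) - exp (f i y)) \<le> exp A * exp (K * (norm x + norm y)) * (K * norm (x - y))"
    by simp
  also have "\<dots> \<le> exp A * exp (K * (norm x + norm y)) * ((K + 1) * (exp (norm x + norm y) * norm (x - y) powr \<alpha>))"
    using K by (intro mult_left_mono mult_mono le_exp_mult_powr \<alpha>) auto
  also have "\<dots> = exp A * (K + 1) * exp ((K + 1) * (norm x + norm y)) * norm (x - y) powr \<alpha>"
    by (simp add: exp_add ring_distribs mult_ac)
  finally show "norm (exp (f i x) - exp (f i y)) \<le>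
      exp A * (K + 1) * exp ((K + 1) * (norm x + norm y)) * norm (x - y) powr \<alpha>" .
qed

text \<open>Telescoping as in the product rule: each of the two mixed terms contributes C D, and the
  exponents add.\<close>

lemma exp_hoelder_scaleR:
  fixes f :: "'i \<Rightarrow> 'v::real_normed_vector \<Rightarrow> real" and g :: "'i \<Rightarrow> 'v \<Rightarrow> 'w::real_normed_vector"
  assumes "exp_hoelder \<alpha> I f" "exp_hoelder \<alpha> I g"
  shows "exp_hoelder \<alpha> I (\<lambda>i x. f i x *\<^sub>R g i x)"
proof -
  obtain C where C: "C \<ge> 0" "\<And>i x. i \<in> I \<Longrightarrow> norm (f i x) \<le> C * exp (C * norm x)"
    "\<And>i x y. i \<in> I \<Longrightarrow> norm (f i x - f i y) \<le> C * exp (C * (norm x + norm y)) * norm (x - y) powr \<alpha>"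
    using assms(1) unfolding exp_hoelder_def by blast
  obtain D where D: "D \<ge> 0" "\<And>i x. i \<in> I \<Longrightarrow> norm (g i x) \<le> D * exp (D * norm x)"
    "\<And>i x y. i \<in> I \<Longrightarrow> norm (g i x - g i y) \<le> D * exp (D * (norm x + norm y)) * norm (x - y) powr \<alpha>"
    using assms(2) unfolding exp_hoelder_def by blast
  show ?thesis
  proof (rule exp_hoelderI[where A = "2 * C * D" and B = "C + D"])
    fix i and x y :: 'v assume i: "i \<in> I"
    let ?d = "norm (x - y) powr \<alpha>" and ?s = "norm x + norm y"
    have "norm (f i x *\<^sub>R g i x) \<le> (C * exp (C * norm x)) * (D * exp (D * norm x))"
      unfolding norm_scaleR real_norm_def[symmetric] using C D i by (intro mult_mono) auto
    also have "\<dots> \<le> 2 * C * D * exp ((C + D) * norm x)"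
      using C D by (simp add: exp_add ring_distribs mult_ac)
    finally show "norm (f i x *\<^sub>R g i x) \<le> 2 * C * D * exp ((C + D) * norm x)" .
    have "norm (f i x) \<le> C * exp (C * ?s)"
      by (rule order_trans[OF C(2)[OF i]]) (use C in \<open>auto intro!: mult_left_mono\<close>)
    then have 1: "norm (f i x) * norm (g i x - g i y) \<le> (C * exp (C * ?s)) * (D * exp (D * ?s) * ?d)"
      using C D i by (intro mult_mono) auto
    have "norm (g i y) \<le> D * exp (D * ?s)"
      by (rule order_trans[OF D(2)[OF i]]) (use D in \<open>auto intro!: mult_left_mono\<close>)
    then have 2: "norm (f i x - f i y) * norm (g i y) \<le> (C * exp (C * ?s) * ?d) * (D * exp (D * ?s))"
      using C D i by (intro mult_mono) auto
    have "f i x *\<^sub>R g i x - f i y *\<^sub>R g i y = f i x *\<^sub>R (g i x - g i y) + (f i x - f i y) *\<^sub>R g i y"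
      by (simp add: algebra_simps)
    then have "norm (f i x *\<^sub>R g i x - f i y *\<^sub>R g i y)
        \<le> norm (f i x) * norm (g i x - g i y) + norm (f i x - f i y) * norm (g i y)"
      by (metis norm_scaleR norm_triangle_ineq real_norm_def)
    also have "\<dots> \<le> 2 * C * D * exp ((C + D) * ?s) * ?d"
      using add_mono[OF 1 2] by (simp add: exp_add ring_distribs mult_ac)
    finally show "norm (f i x *\<^sub>R g i x - f i y *\<^sub>R g i y) \<le> 2 * C * D * exp ((C + D) * ?s) * ?d" .
  qed
qed

section \<open>The integrand of Q\<close>

text \<open>The difference exp s + exp (-s) - 2 is the square of 2 sinh (s/2), and |sinh u| \<ge>
  |u|.\<close>

lemma two_plus_square_le_exp: "2 + s\<^sup>2 \<le> exp s + exp (- s)" for s :: real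
proof -
  let ?r = "exp (s/2) - exp (- (s/2))"
  have "\<bar>s\<bar> \<le> \<bar>?r\<bar>"
    using real_le_abs_sinh[of "s/2"] by (simp add: exp_minus)
  then have "s\<^sup>2 \<le> ?r\<^sup>2" by (rule abs_le_square_iff[THEN iffD1])
  also have "?r\<^sup>2 = exp s + exp (- s) - 2"
  proof -
    have "exp (s/2) * exp (- (s/2)) = 1" by (simp add: mult_exp_exp)
    moreover have "(exp (s/2))\<^sup>2 = exp s" "(exp (- (s/2)))\<^sup>2 = exp (- s)"
      by (simp_all flip: exp_double)
    ultimately show ?thesis unfolding power2_diff by linarith
  qed
  finally show ?thesis by simp
qed

text \<open>The instance in view is \<open>g = ln p\<close>, \<open>G = Dp / p\<close>; then
  \<open>weight \<theta> y\<close> below is the integrand F(y)^2 p(y) / p(y - \<theta>) of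
  \<open>Q\<close>.\<close>

locale log_concave_weight =
  fixes g :: "'v::euclidean_space \<Rightarrow> real" and G :: "'v \<Rightarrow> 'v" and F :: "'v \<Rightarrow> real"
    and \<alpha> K L :: real
  assumes gradient: "\<And>x. GDERIV g x :> G x"
    and hoelder_gradient: "\<And>x y. norm (G x - G y) \<le> K * norm (x - y) powr \<alpha>"
    and K_nonneg: "0 \<le> K"
    and \<alpha>: "0 < \<alpha>" "\<alpha> \<le> 1"
    and strictly_concave: "\<And>x y t. x \<noteq> y \<Longrightarrow> 0 < t \<Longrightarrow> t < 1 \<Longrightarrow>
      (1 - t) * g x + t * g y < g ((1 - t) *\<^sub>R x + t *\<^sub>R y)"
    and lipschitz: "\<And>x y. \<bar>F x - F y\<bar> \<le> L * norm (x - y)"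
    and F_pos: "\<And>x. 0 < F x"
begin

definition weight :: "'v \<Rightarrow> 'v \<Rightarrow> real" where
  "weight \<theta> y = (F y)\<^sup>2 * exp (g y - g (y - \<theta>))"

lemma weight_pos: "0 < weight \<theta> y"
  using F_pos[of y] by (simp add: weight_def)

lemma concave: "concave_on UNIV g"
  unfolding concave_on_def
proof (rule convex_onI)
  fix t :: real and x y assume t: "0 < t" "t < 1"
  show "- g ((1 - t) *\<^sub>R x + t *\<^sub>R y) \<le> (1 - t) * - g x + t * - g y"
  proof (cases "x = y")
    case True
    have "(1 - t) *\<^sub>R x + t *\<^sub>R x = x" "(1 - t) * - g x + t * - g x = - g x"
      by (simp_all add: algebra_simps)
    with True show ?thesis by simp
  next
    case False
    then show ?thesis using strictly_concave[of x y t] t by simp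
  qed
qed simp

lemma continuous_on_g [continuous_intros]:
  assumes "continuous_on S f" shows "continuous_on S (\<lambda>x. g (f x))"
proof -
  have "isCont g x" for x
    using gradient[of x] unfolding gderiv_def by (rule has_derivative_continuous)
  then have "continuous_on UNIV g" by (simp add: continuous_on_eq_continuous_at)
  then show ?thesis by (rule continuous_on_compose2[OF _ assms]) simp
qed

lemma continuous_on_G [continuous_intros]:
  assumes "continuous_on S f" shows "continuous_on S (\<lambda>x. G (f x))"
proof -
  have "isCont G x" for x
    unfolding isCont_def
  proof (rule Lim_null_comparison[THEN LIM_zero_cancel])
    show "\<forall>\<^sub>F y in at x. norm (G y - G x) \<le> K * norm (y - x) powr \<alpha>"
      using hoelder_gradient by simp
    have "((\<lambda>y. K * norm (y - x) powr \<alpha>) \<longlongrightarrow> K * norm (x - x) powr \<alpha>) (at x)"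
      using \<alpha> by (intro tendsto_intros) auto
    then show "((\<lambda>y. K * norm (y - x) powr \<alpha>) \<longlongrightarrow> 0) (at x)" using \<alpha> by simp
  qed
  then have "continuous_on UNIV G" by (simp add: continuous_on_eq_continuous_at)
  then show ?thesis by (rule continuous_on_compose2[OF _ assms]) simp
qed

lemma continuous_on_F [continuous_intros]:
  assumes "continuous_on S f" shows "continuous_on S (\<lambda>x. F (f x))"
proof -
  have "L-lipschitz_on UNIV F"
  proof (rule lipschitz_onI)
    \<comment> \<open>Comparing \<open>F\<close> at 0 and at a unit vector shows that a Lipschitz
      constant is nonnegative.\<close>
    obtain b :: 'v where "norm b = 1" using vector_choose_size[of 1] by auto
    then show "0 \<le> L" using lipschitz[of b 0] by simp
  qed (use lipschitz in \<open>simp add: dist_norm\<close>)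
  then show ?thesis
    by (rule continuous_on_compose2[OF lipschitz_on_continuous_on assms]) simp
qed

lemma continuous_on_weight [continuous_intros]:
  "continuous_on S f \<Longrightarrow> continuous_on S h \<Longrightarrow> continuous_on S (\<lambda>x. weight (f x) (h x))"
  unfolding weight_def by (intro continuous_intros)

text \<open>The gradient in the space variable is \<open>G x - G (x - \<theta>)\<close>, which the
  Hoelder condition bounds uniformly in \<open>x\<close>. Thus the difference grows only linearly
  even where \<open>g\<close> itself decays like a Gaussian exponent, which is why exponential
  moments suffice.\<close>

lemma lipschitz_log_ratio:
  "\<bar>(g x - g (x - \<theta>)) - (g y - g (y - \<theta>))\<bar> \<le> K * norm \<theta> powr \<alpha> * norm (x - y)"
proof -
  have "norm ((\<lambda>x. g x - g (x - \<theta>)) x - (\<lambda>x. g x - g (x - \<theta>)) y) \<le> K * norm \<theta> powr \<alpha> * norm (x - y)"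
  proof (rule differentiable_bound[of UNIV])
    fix x
    have "((\<lambda>x. g (x - \<theta>)) has_derivative (\<lambda>h. h \<bullet> G (x - \<theta>))) (at x)"
      by (rule has_derivative_compose[where g = g and f = "\<lambda>x. x - \<theta>"])
         (use gradient in \<open>auto intro!: derivative_eq_intros simp: gderiv_def\<close>)
    then show "((\<lambda>x. g x - g (x - \<theta>)) has_derivative (\<lambda>h. h \<bullet> (G x - G (x - \<theta>)))) (at x)"
      using gradient[of x] unfolding gderiv_def inner_diff_right by (intro has_derivative_diff)
    show "onorm (\<lambda>h. h \<bullet> (G x - G (x - \<theta>))) \<le> K * norm \<theta> powr \<alpha>"
    proof (rule onorm_le)
      fix h
      have "norm (h \<bullet> (G x - G (x - \<theta>))) \<le> norm h * norm (G x - G (x - \<theta>))"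
        by (simp add: Cauchy_Schwarz_ineq2)
      also have "\<dots> \<le> norm h * (K * norm \<theta> powr \<alpha>)"
        using hoelder_gradient[of x "x - \<theta>"] by (intro mult_left_mono) auto
      finally show "norm (h \<bullet> (G x - G (x - \<theta>))) \<le> K * norm \<theta> powr \<alpha> * norm h"
        by (simp add: mult_ac)
    qed
  qed auto
  then show ?thesis by simp
qed

lemma bounded_on_cball:
  fixes f :: "'v \<Rightarrow> 'w::real_normed_vector"
  assumes "continuous_on UNIV f"
  obtains A where "\<And>\<theta>. \<theta> \<in> cball 0 \<rho> \<Longrightarrow> norm (f \<theta>) \<le> A"
proof -
  have "bounded (f ` cball 0 \<rho>)"
    by (intro compact_imp_bounded compact_continuous_image continuous_on_subset[OF assms]) auto
  then obtain A where "\<forall>z\<in>f ` cball 0 \<rho>. norm z \<le> A" by (auto simp only: bounded_iff)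
  then show ?thesis by (intro that[of A]) blast
qed

lemma exp_hoelder_weight: "exp_hoelder \<alpha> (cball 0 \<rho>) weight"
proof -
  have F: "exp_hoelder \<alpha> (cball 0 \<rho>) (\<lambda>\<theta>. F)"
    by (rule exp_hoelder_lipschitz[where A = "\<bar>F 0\<bar>" and K = L]) (use \<alpha> lipschitz in auto)
  obtain A where A: "\<And>\<theta>. \<theta> \<in> cball 0 \<rho> \<Longrightarrow> norm (g 0 - g (0 - \<theta>)) \<le> A"
    by (rule bounded_on_cball[of "\<lambda>\<theta>. g 0 - g (0 - \<theta>)"]) (auto intro!: continuous_intros)
  have "exp_hoelder \<alpha> (cball 0 \<rho>) (\<lambda>\<theta> y. exp (g y - g (y - \<theta>)))"
  proof (rule exp_hoelder_exp_lipschitz[OF \<alpha>, where A = A and K = "K * \<rho> powr \<alpha>"])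
    fix \<theta> x y :: 'v assume "\<theta> \<in> cball 0 \<rho>"
    then have "K * norm \<theta> powr \<alpha> * norm (x - y) \<le> K * \<rho> powr \<alpha> * norm (x - y)"
      using K_nonneg \<alpha> by (intro mult_right_mono mult_left_mono powr_mono2) auto
    with lipschitz_log_ratio[of x \<theta> y]
    show "\<bar>(g x - g (x - \<theta>)) - (g y - g (y - \<theta>))\<bar> \<le> K * \<rho> powr \<alpha> * norm (x - y)"
      by linarith
  qed (use A K_nonneg in auto)
  from exp_hoelder_scaleR[OF F exp_hoelder_scaleR[OF F this]] show ?thesis
    by (simp add: weight_def[abs_def] power2_eq_square mult.assoc)
qed

text \<open>This is the gradient of the weight in \<theta>. Its factor
  \<open>G (y - \<theta>)\<close> is only \<alpha>-Hoelder in \<open>y\<close>, and this is the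
  origin of the exponent \<alpha> in the rate.\<close>

lemma exp_hoelder_weight_gradient: "exp_hoelder \<alpha> (cball 0 \<rho>) (\<lambda>\<theta> y. weight \<theta> y *\<^sub>R G (y - \<theta>))"
proof -
  obtain A where A: "\<And>\<theta>. \<theta> \<in> cball 0 \<rho> \<Longrightarrow> norm (G (0 - \<theta>)) \<le> A"
    by (rule bounded_on_cball[of "\<lambda>\<theta>. G (0 - \<theta>)"]) (auto intro!: continuous_intros)
  have "exp_hoelder \<alpha> (cball 0 \<rho>) (\<lambda>\<theta> y. G (y - \<theta>))"
  proof (rule exp_hoelder_hoelder[where A = A and K = K])
    show "norm (G (x - \<theta>) - G (y - \<theta>)) \<le> K * norm (x - y) powr \<alpha>" for x y \<theta>
      using hoelder_gradient[of "x - \<theta>" "y - \<theta>"] by simp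
  qed (use \<alpha> A in auto)
  with exp_hoelder_weight show ?thesis by (rule exp_hoelder_scaleR)
qed

lemma weight_has_derivative:
  "((\<lambda>\<theta>. weight \<theta> y) has_derivative (\<lambda>h. h \<bullet> (weight \<theta> y *\<^sub>R G (y - \<theta>)))) (at \<theta>)"
proof -
  have "((\<lambda>\<theta>. g (y - \<theta>)) has_derivative (\<lambda>h. (- h) \<bullet> G (y - \<theta>))) (at \<theta>)"
    by (rule has_derivative_compose[where g = g and f = "\<lambda>\<theta>. y - \<theta>"])
       (use gradient in \<open>auto intro!: derivative_eq_intros simp: gderiv_def\<close>)
  then show ?thesis
    unfolding weight_def by (auto intro!: derivative_eq_intros)
qed

text \<open>Mean value inequality in \<theta> for
  \<open>weight \<theta> x - weight \<theta> y\<close> on the convex ball, whose gradient is already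
  small in |x - y|. The mixed difference thereby keeps both factors, |x - y|^\<alpha> and |\<theta>
  - \<theta>'|.\<close>

lemma weight_increment_bound:
  "\<exists>C\<ge>0. \<forall>\<theta>\<in>cball 0 \<rho>. \<forall>\<theta>'\<in>cball 0 \<rho>. \<forall>x y.
     \<bar>(weight \<theta> x - weight \<theta>' x) - (weight \<theta> y - weight \<theta>' y)\<bar>
       \<le> C * exp (C * (norm x + norm y)) * norm (x - y) powr \<alpha> * norm (\<theta> - \<theta>')"
proof -
  obtain C where C: "0 \<le> C" "\<And>\<theta> x y. \<theta> \<in> cball 0 \<rho> \<Longrightarrow>
      norm (weight \<theta> x *\<^sub>R G (x - \<theta>) - weight \<theta> y *\<^sub>R G (y - \<theta>))
        \<le> C * exp (C * (norm x + norm y)) * norm (x - y) powr \<alpha>"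
    using exp_hoelder_weight_gradient[of \<rho>] unfolding exp_hoelder_def by blast
  have "norm ((\<lambda>\<theta>. weight \<theta> x - weight \<theta> y) \<theta> - (\<lambda>\<theta>. weight \<theta> x - weight \<theta> y) \<theta>')
      \<le> C * exp (C * (norm x + norm y)) * norm (x - y) powr \<alpha> * norm (\<theta> - \<theta>')"
    if "\<theta> \<in> cball 0 \<rho>" "\<theta>' \<in> cball 0 \<rho>" for \<theta> \<theta>' x y
  proof (rule differentiable_bound[of "cball 0 \<rho>"])
    fix \<eta> :: 'v assume \<eta>: "\<eta> \<in> cball 0 \<rho>"
    let ?d = "weight \<eta> x *\<^sub>R G (x - \<eta>) - weight \<eta> y *\<^sub>R G (y - \<eta>)"
    show "((\<lambda>\<theta>. weight \<theta> x - weight \<theta> y) has_derivative (\<lambda>h. h \<bullet> ?d)) (at \<eta> within cball 0 \<rho>)"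
      unfolding inner_diff_right
      by (rule has_derivative_diff; rule has_derivative_at_withinI; rule weight_has_derivative)
    show "onorm (\<lambda>h. h \<bullet> ?d) \<le> C * exp (C * (norm x + norm y)) * norm (x - y) powr \<alpha>"
    proof (rule onorm_le)
      fix h
      have "norm (h \<bullet> ?d) \<le> norm h * norm ?d" by (simp add: Cauchy_Schwarz_ineq2)
      also have "\<dots> \<le> norm h * (C * exp (C * (norm x + norm y)) * norm (x - y) powr \<alpha>)"
        by (intro mult_left_mono C \<eta>) auto
      finally show "norm (h \<bullet> ?d) \<le> C * exp (C * (norm x + norm y)) * norm (x - y) powr \<alpha> * norm h"
        by (simp add: mult_ac)
    qed
  qed (use that in auto)
  moreover have "(weight \<theta> x - weight \<theta>' x) - (weight \<theta> y - weight \<theta>' y)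
      = (weight \<theta> x - weight \<theta> y) - (weight \<theta>' x - weight \<theta>' y)" for \<theta> \<theta>' x y by simp
  ultimately show ?thesis unfolding real_norm_def using C(1) by metis
qed

lemma weight_convex:
  assumes "0 \<le> t" "t \<le> 1"
  shows "weight ((1 - t) *\<^sub>R a + t *\<^sub>R b) y \<le> (1 - t) * weight a y + t * weight b y"
proof -
  have "y - ((1 - t) *\<^sub>R a + t *\<^sub>R b) = (1 - t) *\<^sub>R (y - a) + t *\<^sub>R (y - b)"
    by (simp add: algebra_simps)
  then have "(1 - t) * g (y - a) + t * g (y - b) \<le> g (y - ((1 - t) *\<^sub>R a + t *\<^sub>R b))"
    using convex_onD[OF concave[unfolded concave_on_def], of t "y - a" "y - b"] assms by simp
  then have "exp (g y - g (y - ((1 - t) *\<^sub>R a + t *\<^sub>R b)))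
      \<le> exp ((1 - t) * (g y - g (y - a)) + t * (g y - g (y - b)))"
    by (simp add: algebra_simps)
  also have "\<dots> \<le> (1 - t) * exp (g y - g (y - a)) + t * exp (g y - g (y - b))"
    using convex_onD[OF exp_convex, of t "g y - g (y - a)" "g y - g (y - b)"] assms
    by simp
  finally have "(F y)\<^sup>2 * exp (g y - g (y - ((1 - t) *\<^sub>R a + t *\<^sub>R b)))
      \<le> (F y)\<^sup>2 * ((1 - t) * exp (g y - g (y - a)) + t * exp (g y - g (y - b)))"
    by (rule mult_left_mono) simp
  then show ?thesis by (simp add: weight_def algebra_simps)
qed

text \<open>Log-convexity in the parameter: the tangent is kept inside the exponential. Its linear
  part alone would give plain convexity and lose the square in
  \<open>weight_midpoint\<close>.\<close>

lemma weight_ge_tangent: "weight m y * exp (G (y - m) \<bullet> (b - m)) \<le> weight b y"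
proof -
  have "g (y - b) \<le> g (y - m) - G (y - m) \<bullet> (b - m)"
    using concave_on_le_tangent[OF concave gradient, of "y - b" "y - m"]
    by (simp add: inner_diff_right)
  then have "exp (g y - g (y - m) + G (y - m) \<bullet> (b - m)) \<le> exp (g y - g (y - b))" by simp
  from mult_left_mono[OF this, of "(F y)\<^sup>2"] show ?thesis
    by (simp add: weight_def exp_add[symmetric] mult.assoc)
qed

text \<open>The tangent exponents at \<open>m + d\<close> and \<open>m - d\<close> are opposite, so
  first-order terms cancel and the square survives.\<close>

lemma weight_midpoint:
  "weight m y * (2 + (G (y - m) \<bullet> d)\<^sup>2) \<le> weight (m - d) y + weight (m + d) y"
proof -
  have "weight m y * (2 + (G (y - m) \<bullet> d)\<^sup>2)
      \<le> weight m y * (exp (G (y - m) \<bullet> d) + exp (- (G (y - m) \<bullet> d)))"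
    by (intro mult_left_mono two_plus_square_le_exp less_imp_le[OF weight_pos])
  also have "\<dots> \<le> weight (m + d) y + weight (m - d) y"
    using weight_ge_tangent[of m y "m + d"] weight_ge_tangent[of m y "m - d"]
    by (simp add: ring_distribs)
  finally show ?thesis by simp
qed

text \<open>If every gradient on the ball were orthogonal to \<open>u\<close>, the tangent
  inequality would make \<open>g\<close> equal at both ends of a segment in direction
  \<open>u\<close> and no larger at its midpoint, against strict concavity.\<close>

lemma gradient_not_orthogonal:
  assumes "u \<noteq> 0"
  obtains y where "y \<in> ball 0 1" "G (y - m) \<bullet> u \<noteq> 0"
proof (rule ccontr)
  assume "\<not> thesis"
  with that have orth: "G (y - m) \<bullet> u = 0" if "y \<in> ball 0 1" for y using \<open>y \<in> ball 0 1\<close> by blast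
  \<comment> \<open>Length 1/2 keeps both end points 0 and \<open>b\<close> inside the unit
    ball.\<close>
  define b where "b = (1 / (2 * norm u)) *\<^sub>R u"
  have b: "b \<noteq> 0" "norm b = 1/2" using assms by (auto simp: b_def)
  have tangent: "g (y - m) \<le> g (z - m)" if "z \<in> ball 0 1" "y - z = r *\<^sub>R b" for y z r
    using concave_on_le_tangent[OF concave gradient, of "y - m" "z - m"] orth[OF that(1)] that(2)
    by (simp add: b_def)
  have "g (b - m) = g (0 - m)"
    using tangent[of 0 b 1] tangent[of b 0 "-1"] b by auto
  moreover have "g ((1/2) *\<^sub>R b - m) \<le> g (0 - m)"
    using tangent[of 0 "(1/2) *\<^sub>R b" "1/2"] by simp
  moreover have "(1 - 1/2) *\<^sub>R (0 - m) + (1/2) *\<^sub>R (b - m) = (1/2) *\<^sub>R b - m"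
    by (subst euclidean_eq_iff) (simp add: inner_diff_left inner_add_left algebra_simps)
  ultimately show False
    using strictly_concave[of "0 - m" "b - m" "1/2"] b by auto
qed

end

section \<open>Quadratic growth and stability of the minimizer\<close>

locale weighted_sample = log_concave_weight g G F \<alpha> K L + prob_space M
  for g :: "'v::euclidean_space \<Rightarrow> real" and G F \<alpha> K L and M :: "'a measure" +
  fixes X :: "'a \<Rightarrow> 'v"
  assumes X [measurable]: "X \<in> borel_measurable M"
    and exp_moment: "\<And>m. 0 < m \<Longrightarrow> integrable M (\<lambda>\<omega>. exp (m * norm (X \<omega>)))"
    and full_support: "\<And>U. open U \<Longrightarrow> U \<noteq> {} \<Longrightarrow> 0 < prob (X -` U \<inter> space M)"
begin

lemma integrable_exp_norm: "0 \<le> m \<Longrightarrow> integrable M (\<lambda>\<omega>. exp (m * norm (X \<omega>)))"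
  using exp_moment[of m] by (cases "m = 0") auto

lemma borel_measurable_weight [measurable]: "weight \<theta> \<in> borel_measurable borel"
  by (intro borel_measurable_continuous_onI continuous_intros)

text \<open>The growth condition transfers exponential moments from \<open>X\<close> to
  \<open>Y\<close>. It covers \<open>X\<close> itself with B = 0 and nearest-neighbour
  quantizations, whose triangle inequality produces the factor 2.\<close>

lemma integrable_weight:
  assumes [measurable]: "Y \<in> borel_measurable M" and Y: "\<And>\<omega>. norm (Y \<omega>) \<le> 2 * norm (X \<omega>) + B"
  shows "integrable M (\<lambda>\<omega>. weight \<theta> (Y \<omega>))"
proof -
  obtain C where C: "0 \<le> C" "\<And>y. norm (weight \<theta> y) \<le> C * exp (C * norm y)"
    using exp_hoelder_weight[of "norm \<theta>"] unfolding exp_hoelder_def by fastforce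
  have "integrable M (\<lambda>\<omega>. C * exp (C * B) * exp ((2 * C) * norm (X \<omega>)))"
    using C by (intro integrable_mult_right integrable_exp_norm) auto
  then show ?thesis
  proof (rule Bochner_Integration.integrable_bound)
    have "norm (weight \<theta> (Y \<omega>)) \<le> norm (C * exp (C * B) * exp ((2 * C) * norm (X \<omega>)))" for \<omega>
    proof -
      have "norm (weight \<theta> (Y \<omega>)) \<le> C * exp (C * norm (Y \<omega>))" by (rule C)
      also have "\<dots> \<le> C * exp (C * (2 * norm (X \<omega>) + B))"
        using C Y[of \<omega>] by (intro mult_left_mono) (auto intro: mult_left_mono)
      also have "\<dots> = C * exp (C * B) * exp ((2 * C) * norm (X \<omega>))"
        by (simp add: exp_add[symmetric] ring_distribs mult_ac)
      also have "\<dots> \<le> norm \<dots>" by simp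
      finally show ?thesis .
    qed
    then show "AE \<omega> in M. norm (weight \<theta> (Y \<omega>)) \<le> norm (C * exp (C * B) * exp ((2 * C) * norm (X \<omega>)))"
      by simp
  qed measurable
qed

lemma integrable_square_distance:
  assumes [measurable]: "Y \<in> borel_measurable M" and Y: "\<And>\<omega>. norm (Y \<omega>) \<le> 2 * norm (X \<omega>) + B"
  shows "integrable M (\<lambda>\<omega>. (norm (X \<omega> - Y \<omega>))\<^sup>2)"
proof -
  have "integrable M (\<lambda>\<omega>. exp (2 * B) * exp (6 * norm (X \<omega>)))"
    by (intro integrable_mult_right integrable_exp_norm) auto
  then show ?thesis
  proof (rule Bochner_Integration.integrable_bound)
    have "(norm (X \<omega> - Y \<omega>))\<^sup>2 \<le> exp (2 * B) * exp (6 * norm (X \<omega>))" for \<omega>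
    proof -
      let ?r = "norm (X \<omega> - Y \<omega>)"
      have "?r \<le> 3 * norm (X \<omega>) + B"
        using Y[of \<omega>] norm_triangle_ineq4[of "X \<omega>" "Y \<omega>"] by linarith
      also have "\<dots> \<le> exp (3 * norm (X \<omega>) + B)"
        using exp_ge_add_one_self[of "3 * norm (X \<omega>) + B"] by linarith
      finally have "?r\<^sup>2 \<le> (exp (3 * norm (X \<omega>) + B))\<^sup>2" by (intro power_mono) auto
      also have "\<dots> = exp (2 * B) * exp (6 * norm (X \<omega>))"
        by (simp add: exp_double[symmetric] exp_add[symmetric] algebra_simps)
      finally show ?thesis .
    qed
    then show "AE \<omega> in M. norm ((norm (X \<omega> - Y \<omega>))\<^sup>2) \<le> norm (exp (2 * B) * exp (6 * norm (X \<omega>)))"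
      by (intro AE_I2) simp
  qed measurable
qed

text \<open>A pointwise substitute for Hoelder's inequality. With q = |X - Y| / \<epsilon> and e =
  exp (c |X|), use q^\<alpha> \<le> 1 + q and e q \<le> (e^2 + q^2) / 2. Since q^2 has expectation
  1, the constant does not depend on \<open>Y\<close>; the summand 1 is this expectation.\<close>

lemma weighted_distance_moment:
  assumes [measurable]: "Y \<in> borel_measurable M" and Y: "\<And>\<omega>. norm (Y \<omega>) \<le> 2 * norm (X \<omega>) + B"
    and c: "0 \<le> c"
  defines "\<epsilon> \<equiv> L2norm M (\<lambda>\<omega>. X \<omega> - Y \<omega>)"
  shows "integrable M (\<lambda>\<omega>. exp (c * norm (X \<omega>)) * norm (X \<omega> - Y \<omega>) powr \<alpha>)"
    and "(\<integral>\<omega>. exp (c * norm (X \<omega>)) * norm (X \<omega> - Y \<omega>) powr \<alpha> \<partial>M)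
      \<le> ((\<integral>\<omega>. exp (c * norm (X \<omega>)) \<partial>M) + ((\<integral>\<omega>. exp (2 * c * norm (X \<omega>)) \<partial>M) + 1) / 2) * \<epsilon> powr \<alpha>"
proof -
  let ?D = "\<lambda>\<omega>. norm (X \<omega> - Y \<omega>)"
  note int_D = integrable_square_distance[OF assms(1) Y]
  have \<epsilon>2: "\<epsilon>\<^sup>2 = (\<integral>\<omega>. (?D \<omega>)\<^sup>2 \<partial>M)" and \<epsilon>0: "0 \<le> \<epsilon>"
    by (simp_all add: \<epsilon>_def L2norm_def)
  have int_exp [simp]: "integrable M (\<lambda>\<omega>. exp (c * norm (X \<omega>)))"
    "integrable M (\<lambda>\<omega>. exp (2 * c * norm (X \<omega>)))"
    using integrable_exp_norm[of c] integrable_exp_norm[of "2 * c"] c by auto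
  have "integrable M (\<lambda>\<omega>. exp (c * norm (X \<omega>)) * ?D \<omega> powr \<alpha>) \<and>
     (\<integral>\<omega>. exp (c * norm (X \<omega>)) * ?D \<omega> powr \<alpha> \<partial>M)
      \<le> ((\<integral>\<omega>. exp (c * norm (X \<omega>)) \<partial>M) + ((\<integral>\<omega>. exp (2 * c * norm (X \<omega>)) \<partial>M) + 1) / 2) * \<epsilon> powr \<alpha>"
  \<comment> \<open>Normalizing by \<epsilon> requires \<epsilon> > 0; for \<epsilon> = 0 the
    variables agree almost surely and the integral vanishes.\<close>
  proof (cases "\<epsilon> = 0")
    case True
    with \<epsilon>2 have "AE \<omega> in M. (?D \<omega>)\<^sup>2 = 0"
      using integral_nonneg_eq_0_iff_AE[OF int_D] by simp
    then have ae: "AE \<omega> in M. exp (c * norm (X \<omega>)) * ?D \<omega> powr \<alpha> = 0"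
      by eventually_elim (use \<alpha> in simp)
    then have "integrable M (\<lambda>\<omega>. exp (c * norm (X \<omega>)) * ?D \<omega> powr \<alpha>) \<longleftrightarrow> integrable M (\<lambda>\<omega>. 0::real)"
      by (intro integrable_cong_AE) auto
    moreover have "(\<integral>\<omega>. exp (c * norm (X \<omega>)) * ?D \<omega> powr \<alpha> \<partial>M) = (\<integral>\<omega>. 0 \<partial>M)"
      using ae by (intro integral_cong_AE) auto
    ultimately show ?thesis using True \<alpha> by simp
  next
    case False
    with \<epsilon>0 have \<epsilon>: "0 < \<epsilon>" by simp
    let ?h = "\<lambda>\<omega>. \<epsilon> powr \<alpha> * (exp (c * norm (X \<omega>)) + (exp (2 * c * norm (X \<omega>)) + (?D \<omega>)\<^sup>2 / \<epsilon>\<^sup>2) / 2)"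
    have h: "exp (c * norm (X \<omega>)) * ?D \<omega> powr \<alpha> \<le> ?h \<omega>" for \<omega>
    proof -
      let ?e = "exp (c * norm (X \<omega>))" and ?q = "?D \<omega> / \<epsilon>"
      have "?D \<omega> powr \<alpha> = \<epsilon> powr \<alpha> * ?q powr \<alpha>"
        using \<epsilon> by (simp add: powr_mult[symmetric])
      also have "\<dots> \<le> \<epsilon> powr \<alpha> * (1 + ?q)"
        using \<epsilon> \<alpha> by (intro mult_left_mono powr_le_one_plus) auto
      finally have "?e * ?D \<omega> powr \<alpha> \<le> ?e * (\<epsilon> powr \<alpha> * (1 + ?q))"
        by (rule mult_left_mono) simp
      also have "\<dots> = \<epsilon> powr \<alpha> * (?e + ?e * ?q)" by (simp add: algebra_simps)
      also have "\<dots> \<le> \<epsilon> powr \<alpha> * (?e + (?e\<^sup>2 + ?q\<^sup>2) / 2)"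
      proof -
        have *: "a * b \<le> (a\<^sup>2 + b\<^sup>2) / 2" for a b :: real
          using sum_squares_bound[of a b] by simp
        show ?thesis by (intro mult_left_mono add_left_mono *) simp
      qed
      finally show ?thesis
        by (simp add: exp_double[symmetric] power_divide mult.assoc)
    qed
    have int_h: "integrable M ?h" using int_D by auto
    have int: "integrable M (\<lambda>\<omega>. exp (c * norm (X \<omega>)) * ?D \<omega> powr \<alpha>)"
    proof (rule Bochner_Integration.integrable_bound[OF int_h])
      have "norm (exp (c * norm (X \<omega>)) * ?D \<omega> powr \<alpha>) \<le> norm (?h \<omega>)" for \<omega>
        using order_trans[OF h abs_ge_self, of \<omega>] unfolding real_norm_def
        by (subst abs_of_nonneg) simp_all
      then show "AE \<omega> in M. norm (exp (c * norm (X \<omega>)) * ?D \<omega> powr \<alpha>) \<le> norm (?h \<omega>)" by simp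
    qed measurable
    have "(\<integral>\<omega>. exp (c * norm (X \<omega>)) * ?D \<omega> powr \<alpha> \<partial>M) \<le> (\<integral>\<omega>. ?h \<omega> \<partial>M)"
      by (rule integral_mono[OF int int_h h])
    also have "\<dots> = \<epsilon> powr \<alpha> * ((\<integral>\<omega>. exp (c * norm (X \<omega>)) \<partial>M)
        + ((\<integral>\<omega>. exp (2 * c * norm (X \<omega>)) \<partial>M) + \<epsilon>\<^sup>2 / \<epsilon>\<^sup>2) / 2)"
      using int_D by (simp add: \<epsilon>2)
    finally show ?thesis using int \<epsilon> by (simp add: mult.commute)
  qed
  then show "integrable M (\<lambda>\<omega>. exp (c * norm (X \<omega>)) * ?D \<omega> powr \<alpha>)"
    and "(\<integral>\<omega>. exp (c * norm (X \<omega>)) * ?D \<omega> powr \<alpha> \<partial>M)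
      \<le> ((\<integral>\<omega>. exp (c * norm (X \<omega>)) \<partial>M) + ((\<integral>\<omega>. exp (2 * c * norm (X \<omega>)) \<partial>M) + 1) / 2) * \<epsilon> powr \<alpha>"
    by blast+
qed

text \<open>The constant is fixed before \<open>Y\<close>, so it serves all quantization levels at
  once.\<close>

lemma expected_weight_increment_bound:
  obtains C where "0 \<le> C"
    "\<And>Y \<theta> \<theta>'. Y \<in> borel_measurable M \<Longrightarrow> (\<And>\<omega>. norm (Y \<omega>) \<le> 2 * norm (X \<omega>) + B) \<Longrightarrow>
      norm \<theta> \<le> \<rho> \<Longrightarrow> norm \<theta>' \<le> \<rho> \<Longrightarrow>
      \<bar>((\<integral>\<omega>. weight \<theta> (X \<omega>) \<partial>M) - (\<integral>\<omega>. weight \<theta>' (X \<omega>) \<partial>M)) -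
        ((\<integral>\<omega>. weight \<theta> (Y \<omega>) \<partial>M) - (\<integral>\<omega>. weight \<theta>' (Y \<omega>) \<partial>M))\<bar>
      \<le> C * L2norm M (\<lambda>\<omega>. X \<omega> - Y \<omega>) powr \<alpha> * norm (\<theta> - \<theta>')"
proof -
  obtain C where C: "0 \<le> C" "\<And>\<theta> \<theta>' x y. norm \<theta> \<le> \<rho> \<Longrightarrow> norm \<theta>' \<le> \<rho> \<Longrightarrow>
     \<bar>(weight \<theta> x - weight \<theta>' x) - (weight \<theta> y - weight \<theta>' y)\<bar>
       \<le> C * exp (C * (norm x + norm y)) * norm (x - y) powr \<alpha> * norm (\<theta> - \<theta>')"
    using weight_increment_bound[of \<rho>] unfolding mem_cball_0 Ball_def by blast
  \<comment> \<open>From |X| + |Y| \<le> 3 |X| + B; the shift B becomes the factor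
    \<open>exp (C * B)\<close>.\<close>
  define c where "c = 3 * C"
  have c: "0 \<le> c" using C by (simp add: c_def)
  define E where "E = (\<integral>\<omega>. exp (c * norm (X \<omega>)) \<partial>M) + ((\<integral>\<omega>. exp (2 * c * norm (X \<omega>)) \<partial>M) + 1) / 2"
  have E: "0 \<le> E" by (simp add: E_def)
  show thesis
  proof (rule that[of "C * exp (C * B) * E"])
    show "0 \<le> C * exp (C * B) * E" using C E by simp
    fix Y :: "'a \<Rightarrow> 'v" and \<theta> \<theta>' :: 'v assume meas [measurable]: "Y \<in> borel_measurable M"
      and Y: "\<And>\<omega>. norm (Y \<omega>) \<le> 2 * norm (X \<omega>) + B" and \<theta>: "norm \<theta> \<le> \<rho>" "norm \<theta>' \<le> \<rho>"
    let ?f = "\<lambda>\<omega>. (weight \<theta> (X \<omega>) - weight \<theta>' (X \<omega>)) - (weight \<theta> (Y \<omega>) - weight \<theta>' (Y \<omega>))"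
    let ?k = "C * exp (C * B) * norm (\<theta> - \<theta>')"
    let ?h = "\<lambda>\<omega>. exp (c * norm (X \<omega>)) * norm (X \<omega> - Y \<omega>) powr \<alpha>"
    have intX: "integrable M (\<lambda>\<omega>. weight \<eta> (X \<omega>))" for \<eta>
      by (rule integrable_weight[where B = 0]) auto
    have intY: "integrable M (\<lambda>\<omega>. weight \<eta> (Y \<omega>))" for \<eta>
      by (rule integrable_weight[OF meas Y])
    note int_h = weighted_distance_moment[OF meas Y c]
    have f: "\<bar>?f \<omega>\<bar> \<le> ?k * ?h \<omega>" for \<omega>
    proof -
      have "exp (C * (norm (X \<omega>) + norm (Y \<omega>))) \<le> exp (C * (3 * norm (X \<omega>) + B))"
        using C Y[of \<omega>] by (auto intro!: mult_left_mono)
      also have "\<dots> = exp (C * B) * exp (c * norm (X \<omega>))"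
        by (simp add: exp_add[symmetric] c_def algebra_simps)
      finally have "C * exp (C * (norm (X \<omega>) + norm (Y \<omega>))) * norm (X \<omega> - Y \<omega>) powr \<alpha> * norm (\<theta> - \<theta>')
          \<le> C * (exp (C * B) * exp (c * norm (X \<omega>))) * norm (X \<omega> - Y \<omega>) powr \<alpha> * norm (\<theta> - \<theta>')"
        using C by (intro mult_right_mono mult_left_mono) auto
      also have "\<dots> = ?k * ?h \<omega>" by (simp add: mult_ac)
      finally show ?thesis by (rule order_trans[OF C(2)[OF \<theta>]])
    qed
    have eq: "((\<integral>\<omega>. weight \<theta> (X \<omega>) \<partial>M) - (\<integral>\<omega>. weight \<theta>' (X \<omega>) \<partial>M)) -
        ((\<integral>\<omega>. weight \<theta> (Y \<omega>) \<partial>M) - (\<integral>\<omega>. weight \<theta>' (Y \<omega>) \<partial>M)) = (\<integral>\<omega>. ?f \<omega> \<partial>M)"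
      using intX intY by simp
    have "\<bar>\<integral>\<omega>. ?f \<omega> \<partial>M\<bar> \<le> (\<integral>\<omega>. \<bar>?f \<omega>\<bar> \<partial>M)" by (rule integral_abs_bound)
    also have "\<dots> \<le> (\<integral>\<omega>. ?k * ?h \<omega> \<partial>M)"
    proof (rule integral_mono)
      show "integrable M (\<lambda>\<omega>. \<bar>?f \<omega>\<bar>)" using intX intY by simp
      show "integrable M (\<lambda>\<omega>. ?k * ?h \<omega>)" using int_h(1) by (rule integrable_mult_right)
    qed (rule f)
    also have "\<dots> = ?k * (\<integral>\<omega>. ?h \<omega> \<partial>M)" by simp
    also have "\<dots> \<le> ?k * (E * L2norm M (\<lambda>\<omega>. X \<omega> - Y \<omega>) powr \<alpha>)"
      unfolding E_def using int_h(2) C by (intro mult_left_mono) auto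
    finally have "\<bar>\<integral>\<omega>. ?f \<omega> \<partial>M\<bar> \<le> ?k * (E * L2norm M (\<lambda>\<omega>. X \<omega> - Y \<omega>) powr \<alpha>)" .
    then show "\<bar>((\<integral>\<omega>. weight \<theta> (X \<omega>) \<partial>M) - (\<integral>\<omega>. weight \<theta>' (X \<omega>) \<partial>M)) -
        ((\<integral>\<omega>. weight \<theta> (Y \<omega>) \<partial>M) - (\<integral>\<omega>. weight \<theta>' (Y \<omega>) \<partial>M))\<bar>
      \<le> C * exp (C * B) * E * L2norm M (\<lambda>\<omega>. X \<omega> - Y \<omega>) powr \<alpha> * norm (\<theta> - \<theta>')"
      unfolding eq by (simp only: mult_ac)
  qed
qed

text \<open>By compactness: the truncated expectation is continuous in (m, u) over a ball times the
  unit sphere and attains its minimum. There the integrand is positive on a nonempty open set by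
  \<open>gradient_not_orthogonal\<close>, and full support makes the minimum positive. Integrability
  is part of the conclusion for the sake of the comparison of integrals in
  \<open>quadratic_growth\<close>.\<close>

lemma curvature_lower_bound:
  obtains \<kappa> where "0 < \<kappa>" "\<And>m d. norm m \<le> \<rho> \<Longrightarrow>
    integrable M (\<lambda>\<omega>. indicator (ball 0 1) (X \<omega>) * (weight m (X \<omega>) * (G (X \<omega> - m) \<bullet> d)\<^sup>2)) \<and>
    \<kappa> * (norm d)\<^sup>2 \<le> (\<integral>\<omega>. indicator (ball 0 1) (X \<omega>) * (weight m (X \<omega>) * (G (X \<omega> - m) \<bullet> d)\<^sup>2) \<partial>M)"
proof (cases "\<rho> < 0")
  case True
  then have "\<not> norm m \<le> \<rho>" for m :: 'v using norm_ge_zero[of m] by linarith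
  then show ?thesis using that[of 1] by auto
next
  case False
  define f where "f = (\<lambda>(m, u, y). weight m y * (G (y - m) \<bullet> u)\<^sup>2)"
  have f_nonneg: "0 \<le> f z" for z
    by (auto simp: f_def less_imp_le[OF weight_pos] split: prod.splits)
  have cont: "continuous_on S (\<lambda>x. f (a x, b x, c x))"
    if "continuous_on S a" "continuous_on S b" "continuous_on S c"
    for S :: "'b::topological_space set" and a b c
    using that unfolding f_def prod.case by (intro continuous_intros)
  let ?C = "cball 0 \<rho> \<times> sphere 0 1 :: ('v \<times> 'v) set"
  let ?I = "\<lambda>(m, u) \<omega>. indicator (ball 0 1) (X \<omega>) * f (m, u, X \<omega>)"
  \<comment> \<open>Truncating to \<open>ball 0 1\<close> confines \<open>y\<close> to a compact
    set, so a constant dominates the integrand in the convergence argument.\<close>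
  have "bounded ((\<lambda>(m, u, y). f (m, u, y)) ` (cball 0 \<rho> \<times> sphere 0 1 \<times> cball 0 1))"
    unfolding case_prod_unfold
    by (intro compact_imp_bounded compact_continuous_image cont continuous_intros compact_Times) auto
  then obtain b where b: "\<bar>f (m, u, y)\<bar> \<le> b" if "norm m \<le> \<rho>" "norm u = 1" "norm y \<le> 1" for m u y
    unfolding bounded_iff by fastforce
  have f_meas: "(\<lambda>y. f (m, u, y)) \<in> borel_measurable borel" for m u
    by (intro borel_measurable_continuous_onI cont continuous_intros)
  have meas: "?I z \<in> borel_measurable M" for z
  proof (cases z)
    case (Pair m u)
    show ?thesis unfolding Pair prod.case
      by (intro borel_measurable_times measurable_compose[OF X f_meas]
          measurable_compose[OF X borel_measurable_indicator]) simp
  qed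
  have bound: "norm (?I z \<omega>) \<le> \<bar>b\<bar>" if "z \<in> ?C" for z \<omega>
    using b[of "fst z" "snd z" "X \<omega>"] that by (cases z) (auto simp: indicator_def)
  have int: "integrable M (?I z)" if "z \<in> ?C" for z
    by (rule integrable_const_bound[of _ "\<bar>b\<bar>"]) (use bound[OF that] meas in auto)
  have "continuous_on ?C (\<lambda>z. \<integral>\<omega>. ?I z \<omega> \<partial>M)"
    unfolding continuous_on_sequentially comp_def
  proof (intro allI ballI impI)
    fix z s assume s: "z \<in> ?C" "(\<forall>n. s n \<in> ?C) \<and> s \<longlonglongrightarrow> z"
    show "(\<lambda>n. \<integral>\<omega>. ?I (s n) \<omega> \<partial>M) \<longlonglongrightarrow> (\<integral>\<omega>. ?I z \<omega> \<partial>M)"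
    proof (rule integral_dominated_convergence[where w = "\<lambda>_. \<bar>b\<bar>"])
      show "AE \<omega> in M. (\<lambda>n. ?I (s n) \<omega>) \<longlonglongrightarrow> ?I z \<omega>"
      proof (rule AE_I2)
        fix \<omega>
        have "continuous_on UNIV (\<lambda>z. indicator (ball 0 1) (X \<omega>) * f (fst z, snd z, X \<omega>))"
          by (intro continuous_intros cont)
        then have "(\<lambda>n. indicator (ball 0 1) (X \<omega>) * f (fst (s n), snd (s n), X \<omega>))
            \<longlonglongrightarrow> indicator (ball 0 1) (X \<omega>) * f (fst z, snd z, X \<omega>)"
          using s(2) by (auto simp: continuous_on_sequentially comp_def)
        then show "(\<lambda>n. ?I (s n) \<omega>) \<longlonglongrightarrow> ?I z \<omega>" by (simp add: case_prod_unfold)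
      qed
    qed (use bound s meas in auto)
  qed
  moreover have "compact ?C" "?C \<noteq> {}"
    using False by (auto intro!: compact_Times)
  ultimately obtain z0 where z0: "z0 \<in> ?C" "\<And>z. z \<in> ?C \<Longrightarrow> (\<integral>\<omega>. ?I z0 \<omega> \<partial>M) \<le> (\<integral>\<omega>. ?I z \<omega> \<partial>M)"
    using continuous_attains_inf[of ?C] by blast
  obtain m0 u0 where m0: "z0 = (m0, u0)" by (cases z0)
  have "u0 \<noteq> 0" using z0(1) unfolding m0 by auto
  then obtain y0 where y0: "y0 \<in> ball 0 1" "G (y0 - m0) \<bullet> u0 \<noteq> 0"
    by (rule gradient_not_orthogonal[of u0 m0])
  define U where "U = ball 0 1 \<inter> {y. 0 < f (m0, u0, y)}"
  have "open {y. 0 < f (m0, u0, y)}"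
    by (intro open_Collect_less cont continuous_intros)
  then have "open U" by (auto simp: U_def)
  moreover have "y0 \<in> U" using y0 weight_pos[of m0 y0] by (simp add: U_def f_def)
  ultimately have U: "0 < prob (X -` U \<inter> space M)" using full_support[of U] by auto
  have "(\<integral>\<omega>. ?I z0 \<omega> \<partial>M) \<noteq> 0"
  proof
    assume "(\<integral>\<omega>. ?I z0 \<omega> \<partial>M) = 0"
    then have "AE \<omega> in M. ?I z0 \<omega> = 0"
      using integral_nonneg_eq_0_iff_AE[OF int[OF z0(1)]] f_nonneg m0 by simp
    then have "AE \<omega> in M. X \<omega> \<notin> U"
      by eventually_elim (auto simp: U_def m0)
    moreover have "X -` U \<inter> space M \<in> events"
      using X borel_open[OF \<open>open U\<close>] by (rule measurable_sets)
    ultimately have "prob (X -` U \<inter> space M) = 0"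
      by (subst prob_eq_0) (auto elim: eventually_mono)
    with U show False by simp
  qed
  moreover have "0 \<le> (\<integral>\<omega>. ?I z0 \<omega> \<partial>M)"
    using f_nonneg m0 by (intro integral_nonneg_AE) auto
  ultimately have pos: "0 < (\<integral>\<omega>. ?I z0 \<omega> \<partial>M)" by simp
  show ?thesis
  proof (rule that[OF pos])
    fix m d :: 'v assume m: "norm m \<le> \<rho>"
    let ?J = "\<lambda>\<omega>. indicator (ball 0 1) (X \<omega>) * (weight m (X \<omega>) * (G (X \<omega> - m) \<bullet> d)\<^sup>2)"
    show "integrable M ?J \<and> (\<integral>\<omega>. ?I z0 \<omega> \<partial>M) * (norm d)\<^sup>2 \<le> (\<integral>\<omega>. ?J \<omega> \<partial>M)"
    proof (cases "d = 0")
      case False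
      \<comment> \<open>The form is homogeneous of degree two in \<open>d\<close>, so only the
        direction of \<open>d\<close> matters.\<close>
      let ?z = "(m, sgn d)"
      have z: "?z \<in> ?C" using m False by (simp add: norm_sgn)
      have inner_sgn: "G y \<bullet> d = (G y \<bullet> sgn d) * norm d" for y
        using False by (simp add: sgn_div_norm)
      have J: "?J = (\<lambda>\<omega>. (norm d)\<^sup>2 * ?I ?z \<omega>)"
        unfolding inner_sgn by (simp add: f_def fun_eq_iff power_mult_distrib mult_ac)
      have "(\<integral>\<omega>. ?J \<omega> \<partial>M) = (norm d)\<^sup>2 * (\<integral>\<omega>. ?I ?z \<omega> \<partial>M)" unfolding J by simp
      moreover have "integrable M ?J" unfolding J using int[OF z] by (rule integrable_mult_right)
      ultimately show ?thesis using mult_left_mono[OF z0(2)[OF z], of "(norm d)\<^sup>2"] by (simp add: mult.commute)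
    qed simp
  qed
qed

text \<open>The midpoint inequality between the minimizer and \<theta> gives Q(\<theta>s) +
  Q(\<theta>) \<ge> 2 Q(m) + \<kappa> |d|^2, and Q(m) \<ge> Q(\<theta>s). As |d| is half of
  |\<theta> - \<theta>s|, the constant is \<kappa>/4.\<close>

lemma quadratic_growth:
  assumes min: "\<And>\<theta>. (\<integral>\<omega>. weight \<theta>s (X \<omega>) \<partial>M) \<le> (\<integral>\<omega>. weight \<theta> (X \<omega>) \<partial>M)"
  obtains c where "0 < c" "\<And>\<theta>. norm (\<theta> - \<theta>s) \<le> 1 \<Longrightarrow>
    c * (norm (\<theta> - \<theta>s))\<^sup>2 \<le> (\<integral>\<omega>. weight \<theta> (X \<omega>) \<partial>M) - (\<integral>\<omega>. weight \<theta>s (X \<omega>) \<partial>M)"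
proof -
  obtain \<kappa> where \<kappa>: "0 < \<kappa>" "\<And>m d. norm m \<le> norm \<theta>s + 1 \<Longrightarrow>
    integrable M (\<lambda>\<omega>. indicator (ball 0 1) (X \<omega>) * (weight m (X \<omega>) * (G (X \<omega> - m) \<bullet> d)\<^sup>2)) \<and>
    \<kappa> * (norm d)\<^sup>2 \<le> (\<integral>\<omega>. indicator (ball 0 1) (X \<omega>) * (weight m (X \<omega>) * (G (X \<omega> - m) \<bullet> d)\<^sup>2) \<partial>M)"
    using curvature_lower_bound by blast
  have intX: "integrable M (\<lambda>\<omega>. weight \<eta> (X \<omega>))" for \<eta>
    by (rule integrable_weight[where B = 0]) auto
  show thesis
  proof (rule that[of "\<kappa> / 4"])
    fix \<theta> assume \<theta>: "norm (\<theta> - \<theta>s) \<le> 1"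
    define d where "d = (1/2) *\<^sub>R (\<theta> - \<theta>s)"
    define m where "m = \<theta>s + d"
    have m: "m - d = \<theta>s" "m + d = \<theta>" and d: "norm d = norm (\<theta> - \<theta>s) / 2"
      by (simp_all add: m_def d_def) (subst euclidean_eq_iff, simp add: inner_simps algebra_simps)
    have "norm m \<le> norm \<theta>s + 1"
      using \<theta> d norm_triangle_ineq[of \<theta>s d] by (simp add: m_def)
    note \<kappa> = \<kappa>(1) conjunct1[OF \<kappa>(2)[OF this, of d]] conjunct2[OF \<kappa>(2)[OF this, of d]]
    let ?J = "\<lambda>\<omega>. indicator (ball 0 1) (X \<omega>) * (weight m (X \<omega>) * (G (X \<omega> - m) \<bullet> d)\<^sup>2)"
    have "(\<integral>\<omega>. 2 * weight m (X \<omega>) + ?J \<omega> \<partial>M) \<le> (\<integral>\<omega>. weight \<theta>s (X \<omega>) + weight \<theta> (X \<omega>) \<partial>M)"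
    proof (intro integral_mono Bochner_Integration.integrable_add integrable_mult_right intX \<kappa>)
      fix \<omega>
      have "?J \<omega> \<le> weight m (X \<omega>) * (G (X \<omega> - m) \<bullet> d)\<^sup>2"
        using weight_pos[of m "X \<omega>"] by (auto simp: indicator_def)
      then show "2 * weight m (X \<omega>) + ?J \<omega> \<le> weight \<theta>s (X \<omega>) + weight \<theta> (X \<omega>)"
        using weight_midpoint[of m "X \<omega>" d] by (simp add: m ring_distribs)
    qed
    then have "2 * (\<integral>\<omega>. weight m (X \<omega>) \<partial>M) + (\<integral>\<omega>. ?J \<omega> \<partial>M)
        \<le> (\<integral>\<omega>. weight \<theta>s (X \<omega>) \<partial>M) + (\<integral>\<omega>. weight \<theta> (X \<omega>) \<partial>M)"
      using intX \<kappa>(2) by simp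
    with \<kappa>(3) min[of m] show "\<kappa> / 4 * (norm (\<theta> - \<theta>s))\<^sup>2
        \<le> (\<integral>\<omega>. weight \<theta> (X \<omega>) \<partial>M) - (\<integral>\<omega>. weight \<theta>s (X \<omega>) \<partial>M)"
      by (simp add: d power_divide)
  qed (use \<kappa> in simp)
qed

text \<open>At a point at distance r \<le> 1 from \<theta>s, on the segment to the quantized
  minimizer, c r^2 is at most the increment of \<open>Q\<close> from \<theta>s. The quantized
  increment is nonpositive, so c r^2 \<le> C \<epsilon>^\<alpha> r, and r cancels.\<close>

lemma minimizer_rate:
  assumes min: "\<And>\<theta>. (\<integral>\<omega>. weight \<theta>s (X \<omega>) \<partial>M) \<le> (\<integral>\<omega>. weight \<theta> (X \<omega>) \<partial>M)"
    and Y: "\<And>N::nat. 1 \<le> N \<Longrightarrow> Y N \<in> borel_measurable M"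
      "\<And>N \<omega>. 1 \<le> N \<Longrightarrow> norm (Y N \<omega>) \<le> 2 * norm (X \<omega>) + B"
    and minY: "\<And>N \<theta>. 1 \<le> N \<Longrightarrow> (\<integral>\<omega>. weight (\<theta>h N) (Y N \<omega>) \<partial>M) \<le> (\<integral>\<omega>. weight \<theta> (Y N \<omega>) \<partial>M)"
    and lim: "(\<lambda>N. L2norm M (\<lambda>\<omega>. X \<omega> - Y N \<omega>)) \<longlonglongrightarrow> 0"
  shows "(\<lambda>N. norm (\<theta>h N - \<theta>s)) \<in> O(\<lambda>N. L2norm M (\<lambda>\<omega>. X \<omega> - Y N \<omega>) powr \<alpha>)"
proof -
  let ?\<epsilon> = "\<lambda>N. L2norm M (\<lambda>\<omega>. X \<omega> - Y N \<omega>)"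
  let ?Q = "\<lambda>\<theta>. \<integral>\<omega>. weight \<theta> (X \<omega>) \<partial>M"
  let ?Qh = "\<lambda>N \<theta>. \<integral>\<omega>. weight \<theta> (Y N \<omega>) \<partial>M"
  obtain c where c: "0 < c" "\<And>\<theta>. norm (\<theta> - \<theta>s) \<le> 1 \<Longrightarrow> c * (norm (\<theta> - \<theta>s))\<^sup>2 \<le> ?Q \<theta> - ?Q \<theta>s"
    using quadratic_growth[OF min] by blast
  obtain C where C: "0 \<le> C" "\<And>Y \<theta> \<theta>'. Y \<in> borel_measurable M \<Longrightarrow> (\<And>\<omega>. norm (Y \<omega>) \<le> 2 * norm (X \<omega>) + B) \<Longrightarrow>
      norm \<theta> \<le> norm \<theta>s + 1 \<Longrightarrow> norm \<theta>' \<le> norm \<theta>s + 1 \<Longrightarrow>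
      \<bar>(?Q \<theta> - ?Q \<theta>') - ((\<integral>\<omega>. weight \<theta> (Y \<omega>) \<partial>M) - (\<integral>\<omega>. weight \<theta>' (Y \<omega>) \<partial>M))\<bar>
      \<le> C * L2norm M (\<lambda>\<omega>. X \<omega> - Y \<omega>) powr \<alpha> * norm (\<theta> - \<theta>')"
    using expected_weight_increment_bound[of B "norm \<theta>s + 1"] by blast
  have intY: "integrable M (\<lambda>\<omega>. weight \<eta> (Y N \<omega>))" if "1 \<le> N" for \<eta> N
    using integrable_weight[OF Y(1)[OF that] Y(2)[OF that]] .
  have "((\<lambda>N. C / c * ?\<epsilon> N powr \<alpha>) \<longlongrightarrow> C / c * 0 powr \<alpha>) sequentially"
    using \<alpha> by (intro tendsto_intros tendsto_powr' lim) (auto simp: L2norm_def)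
  then have "\<forall>\<^sub>F N in sequentially. C / c * ?\<epsilon> N powr \<alpha> < 1"
    using \<alpha> by (intro order_tendstoD(2)) auto
  then have "\<forall>\<^sub>F N in sequentially. norm (\<theta>h N - \<theta>s) \<le> C / c * ?\<epsilon> N powr \<alpha>"
    using eventually_ge_at_top[of 1]
  proof eventually_elim
    fix N assume small: "C / c * ?\<epsilon> N powr \<alpha> < 1" and N: "1 \<le> N"
    let ?\<delta> = "norm (\<theta>h N - \<theta>s)"
    \<comment> \<open>Growth and increment bounds are local, and the quantized minimizer is not yet
      known to be near \<open>\<theta>s\<close>; the segment is cut at distance 1.\<close>
    define t where "t = min 1 (1 / ?\<delta>)"
    show "?\<delta> \<le> C / c * ?\<epsilon> N powr \<alpha>"
    proof (cases "\<theta>h N = \<theta>s")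
      case False
      then have t: "0 < t" "t \<le> 1" "t * ?\<delta> \<le> 1" by (auto simp: t_def min_def field_simps)
      define \<theta> where "\<theta> = (1 - t) *\<^sub>R \<theta>s + t *\<^sub>R \<theta>h N"
      have "\<theta> - \<theta>s = t *\<^sub>R (\<theta>h N - \<theta>s)" by (simp add: \<theta>_def algebra_simps)
      then have \<theta>: "norm (\<theta> - \<theta>s) = t * ?\<delta>" using t by simp
      then have "norm \<theta> \<le> norm \<theta>s + 1"
        using t norm_triangle_ineq2[of \<theta> \<theta>s] by linarith
      then have "(?Q \<theta> - ?Q \<theta>s) - (?Qh N \<theta> - ?Qh N \<theta>s) \<le> C * ?\<epsilon> N powr \<alpha> * (t * ?\<delta>)"
        using C(2)[OF Y(1)[OF N] Y(2)[OF N], of \<theta> \<theta>s] \<theta> by simp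
      moreover have "?Qh N \<theta> \<le> ?Qh N \<theta>s"
      proof -
        have "?Qh N \<theta> \<le> (\<integral>\<omega>. (1 - t) * weight \<theta>s (Y N \<omega>) + t * weight (\<theta>h N) (Y N \<omega>) \<partial>M)"
          unfolding \<theta>_def using t
          by (intro integral_mono weight_convex Bochner_Integration.integrable_add
               integrable_mult_right intY[OF N]) auto
        also have "\<dots> = (1 - t) * ?Qh N \<theta>s + t * ?Qh N (\<theta>h N)"
          using intY[OF N] by simp
        also have "\<dots> \<le> (1 - t) * ?Qh N \<theta>s + t * ?Qh N \<theta>s"
          using t by (intro add_left_mono mult_left_mono minY[OF N]) auto
        finally show ?thesis by (simp add: algebra_simps)
      qed
      moreover have "c * (t * ?\<delta>)\<^sup>2 \<le> ?Q \<theta> - ?Q \<theta>s"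
        using c(2)[of \<theta>] \<theta> t by simp
      ultimately have "c * (t * ?\<delta>)\<^sup>2 \<le> C * ?\<epsilon> N powr \<alpha> * (t * ?\<delta>)" by linarith
      then have "(c * (t * ?\<delta>)) * (t * ?\<delta>) \<le> (C * ?\<epsilon> N powr \<alpha>) * (t * ?\<delta>)"
        by (simp add: power2_eq_square mult_ac)
      then have "c * (t * ?\<delta>) \<le> C * ?\<epsilon> N powr \<alpha>"
        by (rule mult_right_le_imp_le) (use t False in simp)
      then have *: "t * ?\<delta> \<le> C / c * ?\<epsilon> N powr \<alpha>"
        using c by (simp add: field_simps)
      \<comment> \<open>If the segment had been cut, t \<delta> would equal 1; the strict inequality
        therefore forces t = 1.\<close>
      with small have "t * ?\<delta> < 1" by linarith
      then have "t = 1" using False by (auto simp: t_def min_def field_simps split: if_splits)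
      with * show ?thesis by simp
    qed (use c C in simp)
  qed
  then show ?thesis by (intro bigoI[of _ "C / c"]) (auto elim: eventually_mono)
qed

end

section \<open>Quantization\<close>

text \<open>An open set of probability zero would be Lebesgue null because the density is positive,
  and nonempty open sets are not negligible.\<close>

lemma distributed_full_support:
  fixes X :: "'a \<Rightarrow> 'v::euclidean_space"
  assumes "prob_space M" and X: "distributed M lborel X (\<lambda>\<xi>. ennreal (p \<xi>))"
    and p: "\<And>\<xi>. 0 < p \<xi>" and U: "open U" "U \<noteq> {}"
  shows "0 < measure M (X -` U \<inter> space M)"
proof (rule ccontr)
  interpret prob_space M by fact
  assume "\<not> ?thesis"
  then have "emeasure M (X -` U \<inter> space M) = 0"
    by (simp add: emeasure_eq_measure zero_less_measure_iff)
  then have "(\<integral>\<^sup>+ \<xi>. ennreal (p \<xi>) * indicator U \<xi> \<partial>lborel) = 0"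
    using distributed_emeasure[OF X] U by simp
  moreover have "(\<lambda>\<xi>. ennreal (p \<xi>) * indicator U \<xi>) \<in> borel_measurable lborel"
    using distributed_borel_measurable[OF X] borel_open[OF U(1)]
    by (intro borel_measurable_times_ennreal borel_measurable_indicator) auto
  ultimately have "AE \<xi> in lborel. ennreal (p \<xi>) * indicator U \<xi> = 0"
    by (simp add: nn_integral_0_iff_AE)
  then have "AE \<xi> in lborel. \<xi> \<notin> U"
    by eventually_elim (use p in \<open>auto simp: indicator_def ennreal_eq_0_iff simp flip: not_less split: if_splits\<close>)
  then have "U \<in> null_sets lborel"
    using U by (subst (asm) AE_iff_null) auto
  then have "negligible U" by (simp add: negligible_iff_null_sets null_sets_completionI)
  with U show False using open_not_negligible by blast
qed

text \<open>The competitor is one fixed sequence through a countable dense set: the distance from X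
  to its first N points tends to 0 pointwise and is dominated by the distance to the first point.
  Optimal quantizers can only do better.\<close>

lemma quantization_error_tendsto_zero:
  fixes X :: "'a \<Rightarrow> real^'n"
  assumes "prob_space M" and [measurable]: "X \<in> borel_measurable M"
    and int: "integrable M (\<lambda>\<omega>. (norm (X \<omega>))\<^sup>2)"
  obtains y where "(\<lambda>N. quantization_error M X N y) \<longlonglongrightarrow> 0"
proof -
  interpret prob_space M by fact
  obtain D :: "(real^'n) set" where D: "countable D" "\<And>U. open U \<Longrightarrow> U \<noteq> {} \<Longrightarrow> \<exists>d\<in>D. d \<in> U"
    using countable_dense_exists by metis
  have D_ne: "D \<noteq> {}" using D(2)[of UNIV] by auto
  \<comment> \<open>Quantization points are numbered from 1, the enumeration of \<open>D\<close>
    from 0.\<close>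
  define y where "y i = from_nat_into D (i - 1)" for i :: nat
  let ?m = "\<lambda>N \<omega>. Min ((\<lambda>i. norm (X \<omega> - y i)) ` {1..N})"
  have m_le: "?m N \<omega> \<le> norm (X \<omega> - y i)" if "1 \<le> i" "i \<le> N" for N i \<omega>
    using that by (intro Min_le) auto
  have m_nonneg: "0 \<le> ?m N \<omega>" if "1 \<le> N" for N \<omega>
    using that by (subst Min_ge_iff) auto
  \<comment> \<open>The shift to \<open>Suc n\<close> avoids the minimum over the empty set at N =
    0.\<close>
  have "(\<lambda>n. \<integral>\<omega>. (?m (Suc n) \<omega>)\<^sup>2 \<partial>M) \<longlonglongrightarrow> (\<integral>\<omega>. 0 \<partial>M)"
  proof (rule integral_dominated_convergence[where w = "\<lambda>\<omega>. 2 * (norm (X \<omega>))\<^sup>2 + 2 * (norm (y 1))\<^sup>2"])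
    show "(\<lambda>\<omega>. (?m (Suc n) \<omega>)\<^sup>2) \<in> borel_measurable M" for n
      by (intro borel_measurable_power borel_measurable_Min) auto
    show "AE \<omega> in M. norm ((?m (Suc n) \<omega>)\<^sup>2) \<le> 2 * (norm (X \<omega>))\<^sup>2 + 2 * (norm (y 1))\<^sup>2" for n
    proof (rule AE_I2)
      fix \<omega>
      have "?m (Suc n) \<omega> \<le> norm (X \<omega>) + norm (y 1)"
        using m_le[of 1 "Suc n" \<omega>] norm_triangle_ineq4[of "X \<omega>" "y 1"] by linarith
      then have "(?m (Suc n) \<omega>)\<^sup>2 \<le> (norm (X \<omega>) + norm (y 1))\<^sup>2"
        using m_nonneg[of "Suc n" \<omega>] by (intro power_mono) auto
      also have "\<dots> \<le> 2 * (norm (X \<omega>))\<^sup>2 + 2 * (norm (y 1))\<^sup>2"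
        using sum_squares_bound[of "norm (X \<omega>)" "norm (y 1)"] by (simp add: power2_sum)
      finally show "norm ((?m (Suc n) \<omega>)\<^sup>2) \<le> 2 * (norm (X \<omega>))\<^sup>2 + 2 * (norm (y 1))\<^sup>2" by simp
    qed
    show "AE \<omega> in M. (\<lambda>n. (?m (Suc n) \<omega>)\<^sup>2) \<longlonglongrightarrow> 0"
    proof (rule AE_I2)
      fix \<omega>
      have "(\<lambda>n. ?m (Suc n) \<omega>) \<longlonglongrightarrow> 0"
      proof (rule LIMSEQ_I)
        fix r :: real assume "0 < r"
        then obtain d where "d \<in> D" "d \<in> ball (X \<omega>) r"
          using D(2)[of "ball (X \<omega>) r"] by auto
        moreover obtain k where "from_nat_into D k = d"
          using from_nat_into_surj[OF D(1) \<open>d \<in> D\<close>] by blast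
        ultimately have "norm (X \<omega> - y (Suc k)) < r" by (simp add: y_def dist_norm)
        moreover have "?m (Suc n) \<omega> \<le> norm (X \<omega> - y (Suc k))" if "k \<le> n" for n
          using that by (intro m_le) auto
        ultimately show "\<exists>no. \<forall>n\<ge>no. norm (?m (Suc n) \<omega> - 0) < r"
          using m_nonneg[of "Suc _" \<omega>] by (intro exI[of _ k] allI impI) (smt (verit) real_norm_def le_add1 plus_1_eq_Suc)
      qed
      then show "(\<lambda>n. (?m (Suc n) \<omega>)\<^sup>2) \<longlonglongrightarrow> 0"
        using tendsto_power[of _ 0 _ 2] by fastforce
    qed
  qed (use int in auto)
  then have "(\<lambda>n. quantization_error M X (Suc n) y) \<longlonglongrightarrow> sqrt 0"
    unfolding quantization_error_def L2norm_def by (intro tendsto_real_sqrt) simp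
  then have "(\<lambda>N. quantization_error M X N y) \<longlonglongrightarrow> 0"
    by (simp add: LIMSEQ_imp_Suc)
  then show ?thesis by (rule that)
qed

lemma L2norm_nearest_neighbour_projection:
  assumes "nearest_neighbour_projection N x Pr" and "1 \<le> N"
  shows "L2norm M (\<lambda>\<omega>. X \<omega> - Pr (X \<omega>)) = quantization_error M X N x"
proof -
  have "norm (\<xi> - Pr \<xi>) = Min ((\<lambda>i. norm (\<xi> - x i)) ` {1..N})" for \<xi>
  proof (rule Min_eqI[symmetric])
    obtain i where "i \<in> {1..N}" "Pr \<xi> = x i"
      using assms(1) unfolding nearest_neighbour_projection_def by blast
    then show "norm (\<xi> - Pr \<xi>) \<in> (\<lambda>i. norm (\<xi> - x i)) ` {1..N}" by auto
  qed (use assms(1) in \<open>auto simp: nearest_neighbour_projection_def\<close>)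
  then show ?thesis unfolding quantization_error_def L2norm_def by simp
qed

text \<open>Some quantization point lies in a ball independent of \<open>N\<close>, and \<open>Pr \<xi>\<close> is at least as close to
  \<open>\<xi>\<close> as that point. This replaces conditional Jensen for the exponential moments of the quantization.\<close>

lemma nearest_neighbour_projection_growth:
  fixes X :: "'a \<Rightarrow> real^'n"
  assumes "prob_space M" and [measurable]: "X \<in> borel_measurable M"
    and int: "integrable M (\<lambda>\<omega>. (norm (X \<omega>))\<^sup>2)"
    and proj: "nearest_neighbour_projection N x Pr" and N: "1 \<le> N"
  shows "norm (Pr \<xi>) \<le> 2 * norm \<xi> +
    sqrt (2 * (\<integral>\<omega>. (norm (X \<omega>))\<^sup>2 \<partial>M) + 2 * (L2norm M (\<lambda>\<omega>. X \<omega> - Pr (X \<omega>)))\<^sup>2)"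
proof -
  interpret prob_space M by fact
  have [measurable]: "Pr \<in> borel_measurable borel"
    and Pr: "\<And>\<xi>. Pr \<xi> \<in> x ` {1..N}" "\<And>\<xi> i. i \<in> {1..N} \<Longrightarrow> norm (\<xi> - Pr \<xi>) \<le> norm (\<xi> - x i)"
    using proj by (auto simp: nearest_neighbour_projection_def)
  \<comment> \<open>Projecting the origin selects a quantization point of minimal norm.\<close>
  obtain i where i: "i \<in> {1..N}" "Pr 0 = x i" using Pr(1)[of 0] by auto
  have i_le: "norm (x i) \<le> norm (x j)" if "j \<in> {1..N}" for j
    using Pr(2)[OF that, of 0] i(2) by simp
  have intD: "integrable M (\<lambda>\<omega>. (norm (X \<omega> - Pr (X \<omega>)))\<^sup>2)"
  proof (rule Bochner_Integration.integrable_bound)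
    show "integrable M (\<lambda>\<omega>. 2 * (norm (X \<omega>))\<^sup>2 + 2 * (norm (x i))\<^sup>2)" using int by auto
    show "AE \<omega> in M. norm ((norm (X \<omega> - Pr (X \<omega>)))\<^sup>2) \<le> norm (2 * (norm (X \<omega>))\<^sup>2 + 2 * (norm (x i))\<^sup>2)"
    proof (rule AE_I2)
      fix \<omega>
      have "norm (X \<omega> - Pr (X \<omega>)) \<le> norm (X \<omega>) + norm (x i)"
        using Pr(2)[OF i(1), of "X \<omega>"] norm_triangle_ineq4[of "X \<omega>" "x i"] by linarith
      then have "(norm (X \<omega> - Pr (X \<omega>)))\<^sup>2 \<le> (norm (X \<omega>) + norm (x i))\<^sup>2"
        by (intro power_mono) auto
      then show "norm ((norm (X \<omega> - Pr (X \<omega>)))\<^sup>2) \<le> norm (2 * (norm (X \<omega>))\<^sup>2 + 2 * (norm (x i))\<^sup>2)"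
        using sum_squares_bound[of "norm (X \<omega>)" "norm (x i)"] by (simp add: power2_sum)
    qed
  qed measurable
  \<comment> \<open>Minimality gives |x i| \<le> |Pr X| \<le> |X| + |X - Pr X| pointwise;
    integrating the constant left-hand side over a probability space bounds it by moments.\<close>
  have "(\<integral>\<omega>. (norm (x i))\<^sup>2 \<partial>M) \<le> (\<integral>\<omega>. 2 * (norm (X \<omega>))\<^sup>2 + 2 * (norm (X \<omega> - Pr (X \<omega>)))\<^sup>2 \<partial>M)"
  proof (rule integral_mono)
    fix \<omega>
    obtain j where j: "j \<in> {1..N}" "Pr (X \<omega>) = x j" using Pr(1)[of "X \<omega>"] by auto
    have "norm (x i) \<le> norm (X \<omega>) + norm (X \<omega> - Pr (X \<omega>))"
      using i_le[OF j(1)] j(2) norm_triangle_ineq2[of "Pr (X \<omega>)" "X \<omega>"]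
      by (simp add: norm_minus_commute)
    then have "(norm (x i))\<^sup>2 \<le> (norm (X \<omega>) + norm (X \<omega> - Pr (X \<omega>)))\<^sup>2"
      by (intro power_mono) auto
    then show "(norm (x i))\<^sup>2 \<le> 2 * (norm (X \<omega>))\<^sup>2 + 2 * (norm (X \<omega> - Pr (X \<omega>)))\<^sup>2"
      using sum_squares_bound[of "norm (X \<omega>)" "norm (X \<omega> - Pr (X \<omega>))"] by (simp add: power2_sum)
  qed (use int intD in auto)
  then have "(norm (x i))\<^sup>2
      \<le> 2 * (\<integral>\<omega>. (norm (X \<omega>))\<^sup>2 \<partial>M) + 2 * (L2norm M (\<lambda>\<omega>. X \<omega> - Pr (X \<omega>)))\<^sup>2"
    using int intD by (simp add: L2norm_def prob_space)
  then have "norm (x i) \<le> sqrt (2 * (\<integral>\<omega>. (norm (X \<omega>))\<^sup>2 \<partial>M) + 2 * (L2norm M (\<lambda>\<omega>. X \<omega> - Pr (X \<omega>)))\<^sup>2)"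
    by (rule real_le_rsqrt)
  moreover have "norm (Pr \<xi>) \<le> 2 * norm \<xi> + norm (x i)"
    using Pr(2)[OF i(1), of \<xi>] norm_triangle_ineq4[of \<xi> "x i"] norm_triangle_ineq2[of "Pr \<xi>" \<xi>]
    by (simp add: norm_minus_commute)
  ultimately show ?thesis by linarith
qed

lemma symmetric_positive_definite_imp_invertible:
  assumes "symmetric_positive_definite A"
  shows "invertible A"
proof -
  have "inj ((*v) A)"
  proof (rule injI)
    fix u v assume "A *v u = A *v v"
    then have "(u - v) \<bullet> (A *v (u - v)) = 0" by (simp add: matrix_vector_mult_diff_distrib)
    then show "u = v" using assms unfolding symmetric_positive_definite_def
      by (metis eq_iff_diff_eq_0 less_irrefl)
  qed
  then show ?thesis
    by (simp add: invertible_left_inverse matrix_left_invertible_injective)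
qed

section \<open>Newton convergence and minimizer rate for optimal quantizers\<close>

theorem theorem2p4:
  fixes M :: "'a measure" and X :: "'a \<Rightarrow> real^'n"
    and p F :: "real^'n \<Rightarrow> real"
    and Dp :: "real^'n \<Rightarrow> real^'n" and D2p :: "real^'n \<Rightarrow> real^'n^'n"
    and \<alpha> a :: real
    and x :: "nat \<Rightarrow> nat \<Rightarrow> real^'n" and Pr :: "nat \<Rightarrow> real^'n \<Rightarrow> real^'n"
    and Xh :: "nat \<Rightarrow> 'a \<Rightarrow> real^'n"
    and \<theta>star :: "real^'n" and \<theta>hat :: "nat \<Rightarrow> real^'n"
  assumes "prob_space M"
    and "distributed M lborel X (\<lambda>\<xi>. ennreal (p \<xi>))"
    and "AE \<xi> in lborel. 0 < p \<xi>"
    and "F \<in> borel_measurable borel"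
    and "integrable M (\<lambda>\<omega>. (F (X \<omega>))\<^sup>2)"
    (* (1) *)
    and "strictly_log_concave p"
    and "(p \<longlongrightarrow> 0) at_infinity"
    (* (2) *)
    and "twice_differentiable_with p Dp D2p"
    and "0 < \<alpha>" and "\<alpha> \<le> 1"
    and "(\<lambda>\<xi>. norm ((1 / p \<xi>) *\<^sub>R Dp \<xi>)) \<in> O[at_infinity](\<lambda>\<xi>. norm \<xi> powr \<alpha>)"
    and "hessian_growth \<alpha> p D2p"
    (* (3) *)
    and "\<And>\<xi>. 0 < F \<xi>"
    and "convex_on UNIV F"
    and "\<exists>L. L-lipschitz_on UNIV F"
    and "1 < a"
    and "integrable M (\<lambda>\<omega>. F (X \<omega>) powr (4 * a))"
    and "\<And>m. 0 < m \<Longrightarrow>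
           integrable M (\<lambda>\<omega>. norm (X \<omega>) powr (4 * a / (a - 1)) + exp (m * norm (X \<omega>)))"
    (* (4) *)
    and "hoelder \<alpha> (\<lambda>\<xi>. (1 / p \<xi>) *\<^sub>R Dp \<xi>)"
    (* quantizers *)
    and "\<And>N. 1 \<le> N \<Longrightarrow> nearest_neighbour_projection N (x N) (Pr N)"
    and "\<And>N. 1 \<le> N \<Longrightarrow> L2_optimal M X N (x N)"
    and "\<And>N. 1 \<le> N \<Longrightarrow> stationary_quantizer M X N (x N) (Pr N)"
    and "\<And>N. Xh N = Pr N \<circ> X"
    (* minimizers *)
    and "unique_global_minimizer (Q_fun M F p X) \<theta>star"
    and "\<And>N. 1 \<le> N \<Longrightarrow> unique_global_minimizer (Q_fun M F p (Xh N)) (\<theta>hat N)"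
  shows
    "(\<forall>N\<ge>1.
        \<comment> \<open>the two premises without which Newton's iteration need not converge\<close>
        continuous_on UNIV D2p \<longrightarrow>
        (\<forall>\<theta>. symmetric_positive_definite (D2Q_fun M F p Dp D2p (Xh N) \<theta>)) \<longrightarrow>
        (\<exists>\<eta>>0. \<forall>\<theta> :: nat \<Rightarrow> real^'n.
           norm (\<theta> 0 - \<theta>hat N) \<le> \<eta> \<longrightarrow>
           (\<forall>n. \<theta> (Suc n) =
                  \<theta> n - matrix_inv (D2Q_fun M F p Dp D2p (Xh N) (\<theta> n))
                          *v DQ_fun M F p Dp (Xh N) (\<theta> n)) \<longrightarrow>
           \<theta> \<longlonglongrightarrow> \<theta>hat N))
     \<and> (\<lambda>N. norm (\<theta>hat N - \<theta>star))
          \<in> O(\<lambda>N. L2norm M (\<lambda>\<omega>. X \<omega> - Xh N \<omega>) powr \<alpha>)"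
proof
  interpret prob_space M by fact
  have X: "X \<in> borel_measurable M"
    using assms(2) by (simp add: distributed_def)
  have p: "0 < p y" for y
    using strictly_log_concave_pos assms(3,6) by blast
  have proj: "Pr N \<in> borel_measurable borel" "\<And>\<xi>. Pr N \<xi> \<in> x N ` {1..N}" if "1 \<le> N" for N
    using assms(20)[OF that] by (auto simp: nearest_neighbour_projection_def)
  have Xh: "Xh N \<in> borel_measurable M" "\<And>\<omega>. Xh N \<omega> \<in> x N ` {1..N}" if "1 \<le> N" for N
    using measurable_compose[OF X proj(1)[OF that]] proj(2)[OF that] assms(23)[of N]
    by (simp_all add: comp_def)
  have min: "Q_fun M F p X \<theta>star \<le> Q_fun M F p X \<theta>" for \<theta>
    using assms(24) by (simp add: unique_global_minimizer_def is_arg_min_def not_less)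
  have minh: "Q_fun M F p (Xh N) (\<theta>hat N) \<le> Q_fun M F p (Xh N) \<theta>" if "1 \<le> N" for N \<theta>
    using assms(25)[OF that] by (simp add: unique_global_minimizer_def is_arg_min_def not_less)
  show "\<forall>N\<ge>1. continuous_on UNIV D2p \<longrightarrow>
        (\<forall>\<theta>. symmetric_positive_definite (D2Q_fun M F p Dp D2p (Xh N) \<theta>)) \<longrightarrow>
        (\<exists>\<eta>>0. \<forall>\<theta> :: nat \<Rightarrow> real^'n.
           norm (\<theta> 0 - \<theta>hat N) \<le> \<eta> \<longrightarrow>
           (\<forall>n. \<theta> (Suc n) =
                  \<theta> n - matrix_inv (D2Q_fun M F p Dp D2p (Xh N) (\<theta> n))
                          *v DQ_fun M F p Dp (Xh N) (\<theta> n)) \<longrightarrow>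
           \<theta> \<longlonglongrightarrow> \<theta>hat N)"
  proof (intro allI impI)
    fix N :: nat
    assume N: "1 \<le> N" and cont: "continuous_on UNIV D2p"
      and spd: "\<forall>\<theta>. symmetric_positive_definite (D2Q_fun M F p Dp D2p (Xh N) \<theta>)"
    have fin: "finite (x N ` {1..N})" "\<And>\<omega>. \<omega> \<in> space M \<Longrightarrow> Xh N \<omega> \<in> x N ` {1..N}"
      using Xh(2)[OF N] by auto
    note quantized = p assms(8) finite_measure_axioms Xh(1)[OF N] fin
    have "GDERIV (Q_fun M F p (Xh N)) (\<theta>hat N) :> DQ_fun M F p Dp (Xh N) (\<theta>hat N)"
      by (rule Q_fun_has_gradient[OF quantized])
    then have "(\<lambda>h. h \<bullet> DQ_fun M F p Dp (Xh N) (\<theta>hat N)) = (\<lambda>h. 0)"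
      unfolding gderiv_def
      by (intro differential_zero_maxmin[of "\<theta>hat N" UNIV]) (use minh[OF N] in auto)
    then have zero: "DQ_fun M F p Dp (Xh N) (\<theta>hat N) = 0"
      by (metis inner_eq_zero_iff)
    show "\<exists>\<eta>>0. \<forall>\<theta> :: nat \<Rightarrow> real^'n.
           norm (\<theta> 0 - \<theta>hat N) \<le> \<eta> \<longrightarrow>
           (\<forall>n. \<theta> (Suc n) =
                  \<theta> n - matrix_inv (D2Q_fun M F p Dp D2p (Xh N) (\<theta> n))
                          *v DQ_fun M F p Dp (Xh N) (\<theta> n)) \<longrightarrow>
           \<theta> \<longlonglongrightarrow> \<theta>hat N"
      using DQ_fun_has_derivative[OF quantized] zero
    proof (rule newton_iteration_converges)
      show "isCont (D2Q_fun M F p Dp D2p (Xh N)) (\<theta>hat N)"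
        using continuous_on_D2Q_fun[OF quantized cont] by (simp add: continuous_on_eq_continuous_at)
      show "invertible (D2Q_fun M F p Dp D2p (Xh N) (\<theta>hat N))"
        using spd by (simp add: symmetric_positive_definite_imp_invertible)
    qed
  qed
  obtain K where K: "\<And>x y. norm ((1 / p x) *\<^sub>R Dp x - (1 / p y) *\<^sub>R Dp y) \<le> K * norm (x - y) powr \<alpha>"
    using assms(19) unfolding hoelder_def by blast
  obtain L where L: "L-lipschitz_on UNIV F" using assms(15) by blast
  \<comment> \<open>The Hoelder constant \<open>K\<close> is not known to be nonnegative, hence its
    absolute value.\<close>
  interpret weighted_sample "\<lambda>y. ln (p y)" "\<lambda>y. (1 / p y) *\<^sub>R Dp y" F \<alpha> "\<bar>K\<bar>" L M X
  proof unfold_locales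
    show "GDERIV (\<lambda>y. ln (p y)) y :> (1 / p y) *\<^sub>R Dp y" for y
      using assms(8) p by (intro GDERIV_DERIV_compose DERIV_ln_divide) (auto simp: twice_differentiable_with_def)
    show "norm ((1 / p x) *\<^sub>R Dp x - (1 / p y) *\<^sub>R Dp y) \<le> \<bar>K\<bar> * norm (x - y) powr \<alpha>" for x y
      by (rule order_trans[OF K]) (simp add: mult_right_mono)
    show "\<bar>F x - F y\<bar> \<le> L * norm (x - y)" for x y
      using lipschitz_onD[OF L, of x y] by (simp add: dist_norm)
    show "(1 - t) * ln (p x) + t * ln (p y) < ln (p ((1 - t) *\<^sub>R x + t *\<^sub>R y))"
      if "x \<noteq> y" "0 < t" "t < 1" for x y and t :: real
      using assms(6) p that unfolding strictly_log_concave_def by blast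
    show "integrable M (\<lambda>\<omega>. exp (m * norm (X \<omega>)))" if "0 < m" for m
      using X by (intro Bochner_Integration.integrable_bound[OF assms(18)[OF that]]) auto
    show "0 < prob (X -` U \<inter> space M)" if "open U" "U \<noteq> {}" for U
      by (rule distributed_full_support[OF assms(1,2) p that])
  qed (use assms X in auto)
  have Q: "Q_fun M F p Y \<theta> = (\<integral>\<omega>. weight \<theta> (Y \<omega>) \<partial>M)" for Y \<theta>
    unfolding Q_fun_def weight_def using p by (simp add: exp_diff)
  have sq: "integrable M (\<lambda>\<omega>. (norm (X \<omega>))\<^sup>2)"
    using integrable_square_distance[of "\<lambda>_. 0" 0] by simp
  have err: "L2norm M (\<lambda>\<omega>. X \<omega> - Xh N \<omega>) = quantization_error M X N (x N)" if "1 \<le> N" for N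
    using L2norm_nearest_neighbour_projection[OF assms(20)[OF that] that] assms(23)[of N] by simp
  have lim: "(\<lambda>N. L2norm M (\<lambda>\<omega>. X \<omega> - Xh N \<omega>)) \<longlonglongrightarrow> 0"
  proof -
    \<comment> \<open>By optimality each quantizer is at least as good as the first N points of this
      sequence.\<close>
    obtain y where y: "(\<lambda>N. quantization_error M X N y) \<longlonglongrightarrow> 0"
      using quantization_error_tendsto_zero[OF assms(1) X sq] .
    have "norm (L2norm M (\<lambda>\<omega>. X \<omega> - Xh N \<omega>)) \<le> quantization_error M X N y" if "1 \<le> N" for N
    proof -
      have "quantization_error M X N (x N) \<le> quantization_error M X N y"
        using assms(21)[OF that] by (simp add: L2_optimal_def is_arg_min_def not_less)
      moreover have "0 \<le> quantization_error M X N (x N)"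
        by (simp add: quantization_error_def L2norm_def)
      ultimately show ?thesis by (simp add: err[OF that])
    qed
    then show ?thesis
      by (intro Lim_null_comparison[OF _ y]) (auto intro: eventually_at_top_linorderI)
  qed
  obtain b where b: "\<And>N. norm (L2norm M (\<lambda>\<omega>. X \<omega> - Xh N \<omega>)) \<le> b"
    using convergent_imp_Bseq[OF convergentI[OF lim]] unfolding Bseq_def by blast
  \<comment> \<open>Convergence bounds all quantization errors by one \<open>b\<close>, so this
    growth constant is the same for every N.\<close>
  define B where "B = sqrt (2 * (\<integral>\<omega>. (norm (X \<omega>))\<^sup>2 \<partial>M) + 2 * b\<^sup>2)"
  have growth: "norm (Xh N \<omega>) \<le> 2 * norm (X \<omega>) + B" if "1 \<le> N" for N \<omega>
  proof -
    have "(L2norm M (\<lambda>\<omega>. X \<omega> - Xh N \<omega>))\<^sup>2 \<le> b\<^sup>2"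
      using b[of N] by (intro power2_le_iff_abs_le[THEN iffD2]) (auto intro: order_trans[OF norm_ge_zero])
    then have "sqrt (2 * (\<integral>\<omega>. (norm (X \<omega>))\<^sup>2 \<partial>M) + 2 * (L2norm M (\<lambda>\<omega>. X \<omega> - Xh N \<omega>))\<^sup>2) \<le> B"
      by (simp add: B_def)
    with nearest_neighbour_projection_growth[OF assms(1) X sq assms(20)[OF that] that, of "X \<omega>"] assms(23)[of N]
    show ?thesis by simp
  qed
  show "(\<lambda>N. norm (\<theta>hat N - \<theta>star)) \<in> O(\<lambda>N. L2norm M (\<lambda>\<omega>. X \<omega> - Xh N \<omega>) powr \<alpha>)"
    using min minh Xh(1) growth lim unfolding Q by (intro minimizer_rate) auto
qed

end
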